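(* Let $\hat{A} \in \mathbb{D}\mathbb{C}^{m \times q}$ and $\hat{B} \in \mathbb{D}\mathbb{C}^{q \times n}$ be dual complex matrices such that $(\hat{A}\hat{B})_{e}=\hat{A}\hat{B}$. If $$\hat{A}^N\hat{A}\hat{B}_{e}=\hat{B}(\hat{A}\hat{B})^N\hat{A}\hat{B} \quad\text{and}\quad \hat{B}\hat{B}^N\hat{A}^*_{e}=\hat{A}^*\hat{A}\hat{B}(\hat{A}\hat{B})^N,$$ then $(\hat{A}\hat{B})^\dag=(\hat{A}\hat{B})^N=\hat{B}^N\hat{A}^N$ (in particular the DMPGI $(\hat A\hat B)^\dag$ exists).
   Context: A dual complex number is $\hat a=a_s+a_d\epsilon$ with $a_s,a_d\in\mathbb{C}$, where $\epsilon$ commutes with complex numbers and $\epsilon^2=0$; it is a dual number if $a_s,a_d\in\mathbb{R}$. A dual number is positive appreciable if $a_s>0$, and positive infinitesimal if $a_s=0$ and $a_d>0$. $\mathbb{D}\mathbb{C}^{m\times n}$ is the set of $m\times n$ dual complex matrices $\hat A=A_s+A_d\epsilon$, $A_s,A_d\in\mathbb{C}^{m\times n}$, and $\hat A^*=A_s^*+A_d^*\epsilon$ (conjugate transpose). $\hat U$ (square) is unitary if $\hat U^*\hat U=\hat U\hat U^*=I$. Known fact (SVD): every $\hat A\in\mathbb{D}\mathbb{C}^{m\times n}$ can be written $\hat A=\hat U\begin{bmatrix}\hat\Sigma_1&O\\O&\hat\Sigma_2\end{bmatrix}\hat V^*$ with $\hat U\in\mathbb{D}\mathbb{C}^{m\times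 m}$, $\hat V\in\mathbb{D}\mathbb{C}^{n\times n}$ unitary, $\hat\Sigma_1=\mathrm{diag}(\hat\mu_1,\dots,\hat\mu_r)$ with positive appreciable dual numbers on the diagonal, and $\hat\Sigma_2$ a (rectangular) diagonal matrix with diagonal entries that are positive infinitesimal dual numbers or zero. The essential part of $\hat A$ is $\hat A_e=\hat U\begin{bmatrix}\hat\Sigma_1&O\\O&O\end{bmatrix}\hat V^*$; $\hat A_e^*$ denotes $(\hat A_e)^*$. The new dual Moore-Penrose inverse (NDMPI) $\hat A^N\in\mathbb{D}\mathbb{C}^{n\times m}$ of $\hat A$ is the unique $\hat X$ (known to exist for every $\hat A$) satisfying $\hat A\hat X\hat A=\hat A_e$, $\hat X\hat A\hat X=\hat X$, $(\hat A\hat X)^*=\hat A\hat X$, $(\hat X\hat A)^*=\hat X\hat A$; in terms of the SVD, $\hat A^N=\hat V\begin{bmatrix}\hat\Sigma_1^{-1}&O\\O&O\end{bmatrix}\hat U^*$. The dual Moore-Penrose generalized inverse (DMPGI) $\hat A^\dag$ of $\hat A$ is the matrix $\hat X\in\mathbb{D}\mathbb{C}^{n\times m}$, when it exists (it is then unique), satisfying the four usual Penrose equations $\hat A\hat X\hat A=\hat A$, $\hat X\hat A\hat X=\hat X$, $(\hat A\hat X)^*=\hat A\hat X$, $(\hat X\hat A)^*=\hat X\hat A$. *)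

theory Defs
  imports Complex_Main "Jordan_Normal_Form.Matrix" "Jordan_Normal_Form.Conjugate"
begin

(* DC a b stands for a + b * eps, where eps commutes with the complex numbers and eps^2 = 0. *)
datatype dual_complex = DC (std_part: complex) (inf_part: complex)

lemma dual_complex_eq_iff:
  "x = y \<longleftrightarrow> std_part x = std_part y \<and> inf_part x = inf_part y"
  by (cases x; cases y) simp

instantiation dual_complex :: comm_ring_1
begin

definition zero_dual_complex :: dual_complex where
  "0 = DC 0 0"

definition one_dual_complex :: dual_complex where
  "1 = DC 1 0"

definition plus_dual_complex :: "dual_complex \<Rightarrow> dual_complex \<Rightarrow> dual_complex" where
  "x + y = DC (std_part x + std_part y) (inf_part x + inf_part y)"

definition uminus_dual_complex :: "dual_complex \<Rightarrow> dual_complex" where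
  "- x = DC (- std_part x) (- inf_part x)"

definition minus_dual_complex :: "dual_complex \<Rightarrow> dual_complex \<Rightarrow> dual_complex" where
  "x - y = DC (std_part x - std_part y) (inf_part x - inf_part y)"

definition times_dual_complex :: "dual_complex \<Rightarrow> dual_complex \<Rightarrow> dual_complex" where
  "x * y = DC (std_part x * std_part y) (std_part x * inf_part y + inf_part x * std_part y)"

instance
  by standard
    (simp_all add: dual_complex_eq_iff zero_dual_complex_def one_dual_complex_def
      plus_dual_complex_def uminus_dual_complex_def minus_dual_complex_def
      times_dual_complex_def algebra_simps)

end

instantiation dual_complex :: conjugatable_ring
begin

definition conjugate_dual_complex :: "dual_complex \<Rightarrow> dual_complex" where
  "conjugate x = DC (cnj (std_part x)) (cnj (inf_part x))"

instance
  by standard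
    (simp_all add: dual_complex_eq_iff conjugate_dual_complex_def zero_dual_complex_def
      plus_dual_complex_def uminus_dual_complex_def times_dual_complex_def)

end

definition is_dual_number :: "dual_complex \<Rightarrow> bool" where
  "is_dual_number x \<longleftrightarrow> std_part x \<in> \<real> \<and> inf_part x \<in> \<real>"

definition positive_appreciable :: "dual_complex \<Rightarrow> bool" where
  "positive_appreciable x \<longleftrightarrow> is_dual_number x \<and> Re (std_part x) > 0"

definition positive_infinitesimal :: "dual_complex \<Rightarrow> bool" where
  "positive_infinitesimal x \<longleftrightarrow> is_dual_number x \<and> std_part x = 0 \<and> Re (inf_part x) > 0"

(* Conjugate transpose. The function mat_adjoint of Schur_Decomposition requires entries in a
   field, which the dual complex numbers are not. *)
definition ctranspose :: "dual_complex mat \<Rightarrow> dual_complex mat" where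
  "ctranspose A = map_mat conjugate (transpose_mat A)"

definition unitary_dc :: "nat \<Rightarrow> dual_complex mat \<Rightarrow> bool" where
  "unitary_dc n U \<longleftrightarrow>
     U \<in> carrier_mat n n \<and> ctranspose U * U = 1\<^sub>m n \<and> U * ctranspose U = 1\<^sub>m n"

(* A = U * [S1, O; O, S2] * V^* with S1 of size r x r and S2 of size (m - r) x (n - r);
   no ordering of the diagonal entries is required. *)
definition is_dc_svd ::
  "dual_complex mat \<Rightarrow> nat \<Rightarrow> dual_complex mat \<Rightarrow> dual_complex mat \<Rightarrow> dual_complex mat
     \<Rightarrow> dual_complex mat \<Rightarrow> bool" where
  "is_dc_svd A r U S1 S2 V \<longleftrightarrow>
     (let m = dim_row A; n = dim_col A in
       r \<le> m \<and> r \<le> n \<and> unitary_dc m U \<and> unitary_dc n V \<and>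
       S1 \<in> carrier_mat r r \<and> diagonal_mat S1 \<and>
       (\<forall>i < r. positive_appreciable (S1 $$ (i, i))) \<and>
       S2 \<in> carrier_mat (m - r) (n - r) \<and> diagonal_mat S2 \<and>
       (\<forall>i < min (m - r) (n - r).
          positive_infinitesimal (S2 $$ (i, i)) \<or> S2 $$ (i, i) = 0) \<and>
       A = U * four_block_mat S1 (0\<^sub>m r (n - r)) (0\<^sub>m (m - r) r) S2 * ctranspose V)"

definition is_essential_part :: "dual_complex mat \<Rightarrow> dual_complex mat \<Rightarrow> bool" where
  "is_essential_part A E \<longleftrightarrow>
     (\<exists>r U S1 S2 V. is_dc_svd A r U S1 S2 V \<and>
        E = U * four_block_mat S1 (0\<^sub>m r (dim_col A - r)) (0\<^sub>m (dim_row A - r) r)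
                  (0\<^sub>m (dim_row A - r) (dim_col A - r)) * ctranspose V)"

definition essential_part :: "dual_complex mat \<Rightarrow> dual_complex mat" where
  "essential_part A = (THE E. is_essential_part A E)"

definition is_ndmpi :: "dual_complex mat \<Rightarrow> dual_complex mat \<Rightarrow> bool" where
  "is_ndmpi A X \<longleftrightarrow>
     X \<in> carrier_mat (dim_col A) (dim_row A) \<and>
     A * X * A = essential_part A \<and> X * A * X = X \<and>
     ctranspose (A * X) = A * X \<and> ctranspose (X * A) = X * A"

definition ndmpi :: "dual_complex mat \<Rightarrow> dual_complex mat" where
  "ndmpi A = (THE X. is_ndmpi A X)"

definition is_dmpgi :: "dual_complex mat \<Rightarrow> dual_complex mat \<Rightarrow> bool" where
  "is_dmpgi A X \<longleftrightarrow>
     X \<in> carrier_mat (dim_col A) (dim_row A) \<and>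
     A * X * A = A \<and> X * A * X = X \<and>
     ctranspose (A * X) = A * X \<and> ctranspose (X * A) = X * A"

(* Meaningful only if some X with is_dmpgi A X exists, which is not the case for every A. *)
definition dmpgi :: "dual_complex mat \<Rightarrow> dual_complex mat" where
  "dmpgi A = (THE X. is_dmpgi A X)"

end

theory Submission
  imports Defs "Jordan_Normal_Form.Schur_Decomposition" "Jordan_Normal_Form.Spectral_Radius"
begin

text \<open>
  Write $E$, $F$ for the essential parts of $A$, $B$; $a$, $b$, $Y$ for the NDMPIs of $A$, $B$, $AB$;
  and $C = AB$, $p = aA$, $s = Bb$. The hypotheses say $pF = BYC$ and $sE^* = A^*CY$. The first one gives
  $pBY = BY$ and $EF = C$, the second one $Es = CYA$, so that $ps = BYA$. Since $bB$ fixes $Y$, one has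
  $sBY = BY$, so $sps = ps$: the product $ps$ is Hermitian and the projections $p$ and $s$ commute.
  Then $Z = ba$ satisfies $CZ = CY$, $ZC = YC$ and $Z = bspa = bpsa = ZCZ = Y$.

  That the definite descriptions defining the essential part and the NDMPI denote needs the
  dual complex SVD. It is obtained by deflation: an eigenvalue of the nonzero standard part of $A^*A$
  lifts to a dual eigenvector by first-order perturbation theory, which splits off a singular value,
  until the remaining block is $\epsilon N$; an ordinary SVD of $N$ finishes the job.
\<close>

section \<open>Conjugate transpose and Penrose equations\<close>

text \<open>A matrix has many SVDs, so that the essential part is well defined is a claim about all
  of them at once. It is settled by trading the SVD for equations: each SVD yields some
  \<open>X\<close> with \<open>essential_pair A E X\<close>, and these equations alone determine
  \<open>E\<close>. The leverage is nilpotency: \<open>A - E\<close> is a multiple of eps, so its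
  products with \<open>X\<close> see only the standard part of \<open>X\<close>, which is the
  complex Moore-Penrose inverse of the standard part of \<open>A\<close> and hence the same for
  every choice. For the existence of an SVD, everything nonlinear is done over the complex numbers,
  and infinitesimal parts then solve linear equations. The delicate case is a multiple eigenvalue:
  not every eigenvector of the standard part lifts, and a suitable one is found by diagonalizing the
  compression of the infinitesimal part to the eigenspace. In the reverse order law,
  \<open>essential_part (A * B) = A * B\<close> makes \<open>Y\<close> a genuine Penrose inverse of
  \<open>C\<close>, whereas \<open>a\<close> and \<open>b\<close> only satisfy
  \<open>A * a * A = E\<close> and \<open>B * b * B = F\<close>.\<close>

definition adj :: "'a :: conjugatable_ring mat \<Rightarrow> 'a mat" where
  "adj A = map_mat conjugate (transpose_mat A)"

text \<open>The polymorphic \<open>adj\<close> serves dual complex matrices and their complex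
  standard and infinitesimal parts alike.\<close>

lemma ctranspose_eq_adj: "ctranspose = adj"
  by (rule ext) (simp add: ctranspose_def adj_def)

lemma dim_adj [simp]: "dim_row (adj A) = dim_col A" "dim_col (adj A) = dim_row A"
  by (simp_all add: adj_def)

lemma index_adj [simp]: "i < dim_col A \<Longrightarrow> j < dim_row A \<Longrightarrow> adj A $$ (i, j) = conjugate (A $$ (j, i))"
  by (simp add: adj_def)

lemma adj_carrier [simp]: "A \<in> carrier_mat m n \<Longrightarrow> adj A \<in> carrier_mat n m"
  by (intro carrier_matI) auto

lemma adj_adj [simp]: "adj (adj A) = A"
  by (rule eq_matI) auto

lemma conjugate_one [simp]: "conjugate (1 :: 'a :: {comm_ring_1, conjugatable_ring}) = 1"
  by (metis conjugate_dist_mul conjugate_id mult_1 mult.commute)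

lemma adj_mult:
  fixes A B :: "'a :: {comm_ring_1, conjugatable_ring} mat"
  assumes "dim_col A = dim_row B"
  shows "adj (A * B) = adj B * adj A"
  using assms
  by (intro eq_matI) (auto simp: scalar_prod_def sum_conjugate conjugate_dist_mul mult.commute intro!: sum.cong)

lemma adj_smult: "adj (k \<cdot>\<^sub>m A) = conjugate k \<cdot>\<^sub>m adj (A :: 'a :: {comm_ring_1, conjugatable_ring} mat)"
  by (rule eq_matI) (auto simp: conjugate_dist_mul)

lemma adj_one [simp]: "adj (1\<^sub>m n :: 'a :: {comm_ring_1, conjugatable_ring} mat) = 1\<^sub>m n"
  by (rule eq_matI) auto

lemma adj_zero [simp]: "adj (0\<^sub>m m n) = 0\<^sub>m n m"
  by (rule eq_matI) auto

text \<open>Premises in the form of dimension equations can be discharged by the simplifier, which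
  thus brings products into right-associated form.\<close>

lemma mult_assoc_dim:
  "dim_col A = dim_row B \<Longrightarrow> dim_col B = dim_row C \<Longrightarrow> (A * B) * C = A * (B * (C :: 'a :: semiring_0 mat))"
  by (rule assoc_mult_mat) auto

definition penrose :: "'a :: {comm_ring_1, conjugatable_ring} mat \<Rightarrow> 'a mat \<Rightarrow> bool" where
  "penrose A X \<longleftrightarrow> dim_row X = dim_col A \<and> dim_col X = dim_row A \<and>
     A * X * A = A \<and> X * A * X = X \<and> adj (A * X) = A * X \<and> adj (X * A) = X * A"

text \<open>Since \<open>A * X\<close> and \<open>A * Y\<close> are Hermitian,
  \<open>A * X = A * Y * (A * X)\<close> is the adjoint of \<open>A * X * (A * Y) = A * Y\<close>,
  so the two agree; likewise \<open>X * A = Y * A\<close>. Then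
  \<open>X = X * A * X = Y * A * X = Y * A * Y = Y\<close>.\<close>

lemma penrose_unique:
  assumes "penrose A X" "penrose A Y"
  shows "X = Y"
proof -
  have d: "dim_row X = dim_col A" "dim_col X = dim_row A" "dim_row Y = dim_col A" "dim_col Y = dim_row A"
    and x: "A * X * A = A" "X * A * X = X" "adj (A * X) = A * X" "adj (X * A) = X * A"
    and y: "A * Y * A = A" "Y * A * Y = Y" "adj (A * Y) = A * Y" "adj (Y * A) = Y * A"
    using assms by (auto simp: penrose_def)
  have "A * X = (A * Y * A) * X" by (simp add: y)
  also have "\<dots> = adj (A * Y) * adj (A * X)" using d by (simp add: x(3) y(3) mult_assoc_dim)
  also have "\<dots> = adj ((A * X * A) * Y)" using d by (simp add: adj_mult mult_assoc_dim)
  also have "\<dots> = A * Y" by (simp add: x y)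
  finally have AX: "A * X = A * Y" .
  have "X * A = X * (A * Y * A)" by (simp add: y)
  also have "\<dots> = adj (X * A) * adj (Y * A)" using d by (simp add: x(4) y(4) mult_assoc_dim)
  also have "\<dots> = adj (Y * (A * X * A))" using d by (simp add: adj_mult mult_assoc_dim)
  also have "\<dots> = Y * A" by (simp add: x y)
  finally have XA: "X * A = Y * A" .
  have "X = X * A * X" by (simp add: x)
  also have "\<dots> = Y * (A * X)" using d by (simp add: XA mult_assoc_dim)
  also have "\<dots> = Y * A * Y" using d by (simp add: AX mult_assoc_dim)
  finally show ?thesis by (simp add: y)
qed

section \<open>Dual matrices, essential part and NDMPI\<close>

lemma std_part_simps [simp]:
  "std_part 0 = 0" "std_part 1 = 1" "std_part (x + y) = std_part x + std_part y"
  "std_part (x * y) = std_part x * std_part y" "std_part (conjugate x) = cnj (std_part x)"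
  by (simp_all add: zero_dual_complex_def one_dual_complex_def plus_dual_complex_def
      times_dual_complex_def conjugate_dual_complex_def)

lemma inf_part_simps [simp]:
  "inf_part 0 = 0" "inf_part 1 = 0" "inf_part (x + y) = inf_part x + inf_part y"
  "inf_part (x * y) = std_part x * inf_part y + inf_part x * std_part y"
  "inf_part (conjugate x) = cnj (inf_part x)"
  by (simp_all add: zero_dual_complex_def one_dual_complex_def plus_dual_complex_def
      times_dual_complex_def conjugate_dual_complex_def)

lemma std_part_sum: "std_part (sum f A) = (\<Sum>x\<in>A. std_part (f x))"
  by (induction A rule: infinite_finite_induct) simp_all

lemma inf_part_sum: "inf_part (sum f A) = (\<Sum>x\<in>A. inf_part (f x))"
  by (induction A rule: infinite_finite_induct) simp_all

definition std_mat :: "dual_complex mat \<Rightarrow> complex mat" where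
  "std_mat A = map_mat std_part A"

definition inf_mat :: "dual_complex mat \<Rightarrow> complex mat" where
  "inf_mat A = map_mat inf_part A"

definition dual_mat :: "complex mat \<Rightarrow> complex mat \<Rightarrow> dual_complex mat" where
  "dual_mat S D = mat (dim_row S) (dim_col S) (\<lambda>ij. DC (S $$ ij) (D $$ ij))"

lemma dim_dual_parts [simp]:
  "dim_row (std_mat A) = dim_row A" "dim_col (std_mat A) = dim_col A"
  "dim_row (inf_mat A) = dim_row A" "dim_col (inf_mat A) = dim_col A"
  "dim_row (dual_mat S D) = dim_row S" "dim_col (dual_mat S D) = dim_col S"
  by (simp_all add: std_mat_def inf_mat_def dual_mat_def)

lemma index_dual_parts [simp]:
  "i < dim_row A \<Longrightarrow> j < dim_col A \<Longrightarrow> std_mat A $$ (i, j) = std_part (A $$ (i, j))"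
  "i < dim_row A \<Longrightarrow> j < dim_col A \<Longrightarrow> inf_mat A $$ (i, j) = inf_part (A $$ (i, j))"
  "i < dim_row S \<Longrightarrow> j < dim_col S \<Longrightarrow> dual_mat S D $$ (i, j) = DC (S $$ (i, j)) (D $$ (i, j))"
  by (simp_all add: std_mat_def inf_mat_def dual_mat_def)

lemma dual_mat_eqI:
  assumes "std_mat A = std_mat B" "inf_mat A = inf_mat B"
  shows "A = B"
proof (rule eq_matI)
  show d: "dim_row A = dim_row B" "dim_col A = dim_col B"
    using arg_cong[OF assms(1), of dim_row] arg_cong[OF assms(1), of dim_col] by simp_all
  fix i j assume "i < dim_row B" "j < dim_col B"
  thus "A $$ (i, j) = B $$ (i, j)"
    using arg_cong[OF assms(1), of "\<lambda>M. M $$ (i, j)"] arg_cong[OF assms(2), of "\<lambda>M. M $$ (i, j)"] d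
    by (simp add: dual_complex_eq_iff)
qed

lemma std_dual_mat [simp]: "std_mat (dual_mat S D) = S"
  by (rule eq_matI) auto

lemma inf_dual_mat [simp]:
  "dim_row D = dim_row S \<Longrightarrow> dim_col D = dim_col S \<Longrightarrow> inf_mat (dual_mat S D) = D"
  by (rule eq_matI) auto

lemma std_mat_mult: "dim_col A = dim_row B \<Longrightarrow> std_mat (A * B) = std_mat A * std_mat B"
  by (intro eq_matI) (auto simp: scalar_prod_def std_part_sum)

lemma inf_mat_mult:
  "dim_col A = dim_row B \<Longrightarrow> inf_mat (A * B) = std_mat A * inf_mat B + inf_mat A * std_mat B"
  by (intro eq_matI) (auto simp: scalar_prod_def inf_part_sum sum.distrib)

lemma std_mat_simps [simp]:
  "std_mat (adj A) = adj (std_mat A)" "std_mat (1\<^sub>m n) = 1\<^sub>m n" "std_mat (0\<^sub>m m n) = 0\<^sub>m m n"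
  "std_mat (k \<cdot>\<^sub>m A) = std_part k \<cdot>\<^sub>m std_mat A"
  by (auto intro!: eq_matI)

lemma inf_mat_simps [simp]:
  "inf_mat (adj A) = adj (inf_mat A)" "inf_mat (1\<^sub>m n) = 0\<^sub>m n n" "inf_mat (0\<^sub>m m n) = 0\<^sub>m m n"
  "inf_mat (k \<cdot>\<^sub>m A) = std_part k \<cdot>\<^sub>m inf_mat A + inf_part k \<cdot>\<^sub>m std_mat A"
  by (auto intro!: eq_matI)

text \<open>Taking the standard part is multiplicative and commutes with \<open>adj\<close>, so it
  preserves all four equations.\<close>

lemma penrose_std_mat:
  assumes "penrose A X"
  shows "penrose (std_mat A) (std_mat X)"
proof -
  have d: "dim_row X = dim_col A" "dim_col X = dim_row A"
    and x: "A * X * A = A" "X * A * X = X" "adj (A * X) = A * X" "adj (X * A) = X * A"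
    using assms by (auto simp: penrose_def)
  show ?thesis
    using d arg_cong[OF x(1), of std_mat] arg_cong[OF x(2), of std_mat]
      arg_cong[OF x(3), of std_mat] arg_cong[OF x(4), of std_mat]
    by (simp add: penrose_def std_mat_mult)
qed

text \<open>Characterizes essential part and NDMPI together without reference to an SVD;
  the difference $A - E$ is infinitesimal and annihilated by $X$ on both sides.\<close>

definition essential_pair :: "dual_complex mat \<Rightarrow> dual_complex mat \<Rightarrow> dual_complex mat \<Rightarrow> bool" where
  "essential_pair A E X \<longleftrightarrow> penrose E X \<and> std_mat A = std_mat E \<and> A * X = E * X \<and> X * A = X * E"

text \<open>As $A - E$ is infinitesimal, $X(A - E)$ depends only on the standard part of $X$.\<close>

lemma mult_infinitesimal_cong:
  assumes d: "dim_row X = dim_col A" "dim_col X = dim_row A"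
    and s: "std_mat A = std_mat E" "std_mat X = std_mat Y"
  shows "X * A = X * E \<Longrightarrow> Y * A = Y * E" and "A * X = E * X \<Longrightarrow> A * Y = E * Y"
proof -
  have d': "dim_row E = dim_row A" "dim_col E = dim_col A" "dim_row Y = dim_row X" "dim_col Y = dim_col X"
    using arg_cong[OF s(1), of dim_row] arg_cong[OF s(1), of dim_col]
      arg_cong[OF s(2), of dim_row] arg_cong[OF s(2), of dim_col] by simp_all
  have cancel: "L = L'" if "L + M = L' + M \<or> M + L = M + L'" "dim_row L = dim_row M" "dim_col L = dim_col M"
    "dim_row L' = dim_row M" "dim_col L' = dim_col M" for L L' M :: "complex mat"
  proof (rule eq_matI)
    fix i j assume "i < dim_row L'" "j < dim_col L'"
    moreover have "(L + M) $$ (i, j) = (L' + M) $$ (i, j) \<or> (M + L) $$ (i, j) = (M + L') $$ (i, j)"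
      using that(1) by metis
    ultimately show "L $$ (i, j) = L' $$ (i, j)" using that(2-) by simp
  qed (use that in simp_all)
  show "Y * A = Y * E" if "X * A = X * E"
  proof (rule dual_mat_eqI)
    \<comment> \<open>Equal standard parts of \<open>A\<close> and \<open>E\<close> make the second
      summands coincide. After cancelling them only the standard part of \<open>X\<close> remains,
      and it may be exchanged for that of \<open>Y\<close>.\<close>
    have "std_mat X * inf_mat A + inf_mat X * std_mat E = std_mat X * inf_mat E + inf_mat X * std_mat E"
      using arg_cong[OF that, of inf_mat] d d' by (simp add: inf_mat_mult s)
    from cancel[OF disjI1, OF this] have "std_mat Y * inf_mat A = std_mat Y * inf_mat E"
      using d d' by (simp add: s)
    thus "inf_mat (Y * A) = inf_mat (Y * E)" using d d' by (simp add: inf_mat_mult s)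
  qed (use d d' in \<open>simp add: std_mat_mult s\<close>)
  show "A * Y = E * Y" if "A * X = E * X"
  proof (rule dual_mat_eqI)
    have "std_mat E * inf_mat X + inf_mat A * std_mat X = std_mat E * inf_mat X + inf_mat E * std_mat X"
      using arg_cong[OF that, of inf_mat] d d' by (simp add: inf_mat_mult s)
    from cancel[OF disjI2, OF this] have "inf_mat A * std_mat Y = inf_mat E * std_mat Y"
      using d d' by (simp add: s)
    thus "inf_mat (A * Y) = inf_mat (E * Y)" using d d' by (simp add: inf_mat_mult s)
  qed (use d d' in \<open>simp add: std_mat_mult s\<close>)
qed

text \<open>\<open>X\<close> and \<open>Y\<close> have the same standard part, so each may replace
  the other in products with an infinitesimal difference: \<open>F * X = E * X\<close>,
  \<open>E * Y = F * Y\<close> and \<open>Y * E = Y * F\<close>. Hence each of the Hermitian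
  projections \<open>E * X\<close> and \<open>F * Y\<close> absorbs the other, so they are equal,
  and \<open>E = E * X * E = F * Y * E = F * Y * F = F\<close>.\<close>

lemma essential_pair_unique:
  assumes 1: "essential_pair A E X" and 2: "essential_pair A F Y"
  shows "E = F"
proof -
  have sE: "std_mat A = std_mat E" and sF: "std_mat A = std_mat F"
    using 1 2 by (auto simp: essential_pair_def)
  have dE: "dim_row E = dim_row A" "dim_col E = dim_col A"
    using arg_cong[OF sE, of dim_row] arg_cong[OF sE, of dim_col] by simp_all
  have dF: "dim_row F = dim_row A" "dim_col F = dim_col A"
    using arg_cong[OF sF, of dim_row] arg_cong[OF sF, of dim_col] by simp_all
  have pE: "penrose E X" and pF: "penrose F Y" using 1 2 by (auto simp: essential_pair_def)
  have d: "dim_row X = dim_col A" "dim_col X = dim_row A" "dim_row Y = dim_col A" "dim_col Y = dim_row A"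
    using pE pF dE dF by (auto simp: penrose_def)
  have x: "E * X * E = E" "X * E * X = X" "adj (E * X) = E * X" "adj (X * E) = X * E"
    and y: "F * Y * F = F" "Y * F * Y = Y" "adj (F * Y) = F * Y" "adj (Y * F) = Y * F"
    using pE pF by (auto simp: penrose_def)
  have sXY: "std_mat X = std_mat Y"
    using penrose_unique[OF penrose_std_mat[OF pE]] penrose_std_mat[OF pF] sE sF by simp
  have FX: "F * X = E * X" and EY: "E * Y = F * Y" and YE: "Y * E = Y * F"
    using mult_infinitesimal_cong[of Y A F X] mult_infinitesimal_cong[of X A E Y]
      d sE sF sXY 1 2 unfolding essential_pair_def by metis+
  have a: "E * X * (F * Y) = F * Y"
  proof -
    have "E * X * (F * Y) = E * X * (E * Y)" by (simp only: EY)
    also have "\<dots> = E * X * E * Y" using d dE dF by (simp add: mult_assoc_dim)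
    finally show ?thesis by (simp add: x EY)
  qed
  have b: "F * Y * (E * X) = E * X"
  proof -
    have "F * Y * (E * X) = F * Y * (F * X)" by (simp only: FX)
    also have "\<dots> = F * Y * F * X" using d dE dF by (simp add: mult_assoc_dim)
    finally show ?thesis by (simp add: y FX)
  qed
  have "adj (E * X * (F * Y)) = E * X" using b x y d dE dF by (simp add: adj_mult[of "E * X"])
  hence eq: "E * X = F * Y" using a y by simp
  have "E = E * X * E" by (simp add: x)
  also have "\<dots> = F * Y * E" by (simp only: eq)
  also have "\<dots> = F * (Y * E)" using d dE dF by (simp add: mult_assoc_dim)
  also have "\<dots> = F * Y * F" unfolding YE using d dE dF by (simp add: mult_assoc_dim)
  finally show ?thesis by (simp add: y)
qed

text \<open>Any solution \<open>Z\<close> has \<open>E * Z = A * Z * A * Z = A * Z\<close> and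
  likewise \<open>Z * E = Z * A\<close>; it is therefore a Penrose inverse of \<open>E\<close>, of
  which there is only one. Conversely \<open>A * X * A = E * X * A = E * X * E = E\<close>.\<close>

lemma ndmpi_characterization:
  assumes ess: "essential_part A = E" and pair: "essential_pair A E X"
  shows "is_ndmpi A Z \<longleftrightarrow> Z = X"
proof
  have sE: "std_mat A = std_mat E" and pE: "penrose E X" and AX: "A * X = E * X" "X * A = X * E"
    using pair by (auto simp: essential_pair_def)
  have dE: "dim_row E = dim_row A" "dim_col E = dim_col A"
    using arg_cong[OF sE, of dim_row] arg_cong[OF sE, of dim_col] by simp_all
  have dX: "dim_row X = dim_col A" "dim_col X = dim_row A" using pE dE by (auto simp: penrose_def)
  {
    assume "Z = X"
    have "A * X * A = E * (X * A)" using AX dX dE by (simp add: mult_assoc_dim)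
    also have "\<dots> = E * X * E" unfolding AX using AX dX dE by (simp add: mult_assoc_dim)
    finally have "A * X * A = E" using pE by (simp add: penrose_def)
    thus "is_ndmpi A Z"
      using pE dX unfolding is_ndmpi_def \<open>Z = X\<close> ess
      by (auto simp: AX ctranspose_eq_adj penrose_def)
  }
  assume "is_ndmpi A Z"
  hence z: "A * Z * A = E" "Z * A * Z = Z" "adj (A * Z) = A * Z" "adj (Z * A) = Z * A"
    and dZ: "dim_row Z = dim_col A" "dim_col Z = dim_row A"
    by (auto simp: is_ndmpi_def ess ctranspose_eq_adj)
  have EZ: "E * Z = A * Z"
  proof -
    have "E * Z = A * Z * A * Z" by (simp only: z)
    also have "\<dots> = A * (Z * A * Z)" using dZ by (simp add: mult_assoc_dim)
    finally show ?thesis by (simp only: z)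
  qed
  have ZE: "Z * E = Z * A"
  proof -
    have "Z * E = Z * (A * Z * A)" by (simp only: z)
    also have "\<dots> = Z * A * Z * A" using dZ by (simp add: mult_assoc_dim)
    finally show ?thesis by (simp only: z)
  qed
  have "penrose E Z"
    unfolding penrose_def EZ ZE
  proof (intro conjI)
    have "A * Z * E = A * (Z * E)" using dZ dE by (simp add: mult_assoc_dim)
    also have "\<dots> = A * Z * A" unfolding ZE using dZ dE by (simp add: mult_assoc_dim)
    finally show "A * Z * E = E" by (simp only: z)
  qed (use z dZ dE in simp_all)
  from penrose_unique[OF this pE] show "Z = X" .
qed

section \<open>Block diagonal matrices and the complex spectral theorem\<close>

lemma mult_smult_dim:
  fixes A B :: "'a :: comm_ring_1 mat"
  assumes "dim_col A = dim_row B"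
  shows "(k \<cdot>\<^sub>m A) * B = k \<cdot>\<^sub>m (A * B)" "A * (k \<cdot>\<^sub>m B) = k \<cdot>\<^sub>m (A * B)"
  using assms by (auto intro!: mult_smult_assoc_mat mult_smult_distrib)

definition unitary_mat :: "nat \<Rightarrow> 'a :: {comm_ring_1, conjugatable_ring} mat \<Rightarrow> bool" where
  "unitary_mat n U \<longleftrightarrow> U \<in> carrier_mat n n \<and> adj U * U = 1\<^sub>m n \<and> U * adj U = 1\<^sub>m n"

lemma unitary_dc_eq: "unitary_dc = unitary_mat"
  by (intro ext) (simp add: unitary_dc_def unitary_mat_def ctranspose_eq_adj)

text \<open>The last two rules cancel \<open>U\<close> against \<open>adj U\<close> at the head of a
  right-associated product.\<close>

lemma unitary_matD:
  assumes "unitary_mat n U"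
  shows "dim_row U = n" "dim_col U = n" "adj U * U = 1\<^sub>m n" "U * adj U = 1\<^sub>m n"
    "dim_row X = n \<Longrightarrow> adj U * (U * X) = X" "dim_row X = n \<Longrightarrow> U * (adj U * X) = X"
proof -
  show d: "dim_row U = n" "dim_col U = n" "adj U * U = 1\<^sub>m n" "U * adj U = 1\<^sub>m n"
    using assms by (auto simp: unitary_mat_def)
  assume X: "dim_row X = n"
  have "adj U * (U * X) = adj U * U * X" "U * (adj U * X) = U * adj U * X"
    using d(1,2) X by (simp_all add: mult_assoc_dim)
  moreover have "1\<^sub>m n * X = X" using X by (intro left_mult_one_mat) auto
  ultimately show "adj U * (U * X) = X" "U * (adj U * X) = X" by (simp_all add: d)
qed

lemma unitary_mat_one: "unitary_mat n (1\<^sub>m n)"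
  by (simp add: unitary_mat_def)

lemma unitary_mat_mult:
  assumes U: "unitary_mat n U" and V: "unitary_mat n V"
  shows "unitary_mat n (U * V)"
  using unitary_matD[OF U] unitary_matD[OF V]
  by (auto simp: unitary_mat_def adj_mult mult_assoc_dim)

definition block_diag :: "'a :: zero mat \<Rightarrow> 'a mat \<Rightarrow> 'a mat" where
  "block_diag A B = four_block_mat A (0\<^sub>m (dim_row A) (dim_col B)) (0\<^sub>m (dim_row B) (dim_col A)) B"

lemma dim_block_diag [simp]:
  "dim_row (block_diag A B) = dim_row A + dim_row B" "dim_col (block_diag A B) = dim_col A + dim_col B"
  by (simp_all add: block_diag_def)

lemma block_diag_assoc: "block_diag (block_diag A B) C = block_diag A (block_diag B C)"
  using assoc_four_block_mat[of A B C] by (simp add: block_diag_def)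

lemma block_diag_mult:
  fixes A B C D :: "'a :: comm_ring_1 mat"
  assumes "dim_col A = dim_row B" "dim_col C = dim_row D"
  shows "block_diag A C * block_diag B D = block_diag (A * B) (C * D)"
proof -
  obtain a b c a' b' c' where
    c: "A \<in> carrier_mat a b" "C \<in> carrier_mat a' b'" "B \<in> carrier_mat b c" "D \<in> carrier_mat b' c'"
    using assms by (metis carrier_mat_triv)
  hence m: "A * B \<in> carrier_mat a c" "C * D \<in> carrier_mat a' c'" by auto
  from c have d: "dim_row A = a" "dim_col A = b" "dim_row B = b" "dim_col B = c"
    "dim_row C = a'" "dim_col C = b'" "dim_row D = b'" "dim_col D = c'" by auto
  have "block_diag A C * block_diag B D =
    four_block_mat (A * B + 0\<^sub>m a b' * 0\<^sub>m b' c) (A * 0\<^sub>m b c' + 0\<^sub>m a b' * D)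
      (0\<^sub>m a' b * B + C * 0\<^sub>m b' c) (0\<^sub>m a' b * 0\<^sub>m b c' + C * D)"
    unfolding block_diag_def d
    by (rule mult_four_block_mat[OF c(1) zero_carrier_mat zero_carrier_mat c(2) c(3)
          zero_carrier_mat zero_carrier_mat c(4)])
  also have "\<dots> = block_diag (A * B) (C * D)"
    using c m by (simp add: block_diag_def d)
  finally show ?thesis .
qed

lemma adj_block_diag: "adj (block_diag A B) = block_diag (adj A) (adj (B :: 'a :: conjugatable_ring mat))"
  by (rule eq_matI) (auto simp: block_diag_def)

lemma block_diag_one: "block_diag (1\<^sub>m m) (1\<^sub>m n) = 1\<^sub>m (m + n)"
  by (simp add: block_diag_def)

lemma unitary_block_diag:
  assumes U: "unitary_mat m U" and V: "unitary_mat n V"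
  shows "unitary_mat (m + n) (block_diag U V)"
  using unitary_matD[OF U] unitary_matD[OF V]
  by (auto simp: unitary_mat_def adj_block_diag block_diag_mult block_diag_one intro!: carrier_matI)

text \<open>The common induction step of the decompositions below: a factorization of the lower
  right block is absorbed into the outer factors.\<close>

lemma block_diag_deflate:
  fixes A :: "'a :: {comm_ring_1, conjugatable_ring} mat"
  assumes A: "A = U0 * block_diag S (U * R * adj V) * adj V0"
    and d: "dim_col U = dim_row R" "dim_col V = dim_col R"
      "dim_col U0 = dim_row S + dim_row U" "dim_col V0 = dim_col S + dim_row V"
  shows "A = (U0 * block_diag (1\<^sub>m (dim_row S)) U) * block_diag S R * adj (V0 * block_diag (1\<^sub>m (dim_col S)) V)"
proof -
  have S: "1\<^sub>m (dim_row S) * (S * 1\<^sub>m (dim_col S)) = S"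
    by (metis carrier_mat_triv left_mult_one_mat right_mult_one_mat)
  have X: "block_diag S (U * R * adj V)
      = block_diag (1\<^sub>m (dim_row S)) U * (block_diag S R * block_diag (1\<^sub>m (dim_col S)) (adj V))"
    using d by (simp add: mult_assoc_dim block_diag_mult S)
  show ?thesis
    unfolding A X using d
    by (simp add: adj_mult adj_block_diag mult_assoc_dim)
qed

text \<open>Vectors are treated as one-column matrices, so that \<open>adj\<close> and the rules for
  matrix products apply to them.\<close>

definition unit_col :: "nat \<Rightarrow> nat \<Rightarrow> 'a :: zero_neq_one mat" where
  "unit_col n k = mat n 1 (\<lambda>(i, j). if i = k then 1 else 0)"

lemma dim_unit_col [simp]: "dim_row (unit_col n k) = n" "dim_col (unit_col n k) = 1"
  by (simp_all add: unit_col_def)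

lemma index_unit_col [simp]: "i < n \<Longrightarrow> unit_col n k $$ (i, 0) = (if i = k then 1 else 0)"
  by (simp add: unit_col_def)

lemma mult_unit_col:
  fixes A :: "'a :: comm_ring_1 mat"
  assumes "dim_col A = n" "i < dim_row A" "k < n"
  shows "(A * unit_col n k) $$ (i, 0) = A $$ (i, k)"
proof -
  have "(A * unit_col n k) $$ (i, 0) = (\<Sum>j = 0..<n. A $$ (i, j) * (if j = k then 1 else 0))"
    using assms by (simp add: scalar_prod_def)
  also have "\<dots> = (\<Sum>j = 0..<n. if j = k then A $$ (i, j) else 0)"
    by (intro sum.cong) auto
  finally show ?thesis using assms by simp
qed

text \<open>The premises describe the first column of \<open>M\<close> and its conjugated first row;
  only the corner entry \<open>s\<close> survives in either.\<close>

lemma deflation: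
  fixes M :: "'a :: {comm_ring_1, conjugatable_ring} mat"
  assumes M: "M \<in> carrier_mat (Suc m) (Suc n)"
    and col: "M * unit_col (Suc n) 0 = s \<cdot>\<^sub>m unit_col (Suc m) 0"
    and row: "adj M * unit_col (Suc m) 0 = t \<cdot>\<^sub>m unit_col (Suc n) 0"
  shows "\<exists>M' \<in> carrier_mat m n. M = block_diag (mat 1 1 (\<lambda>_. s)) M'"
proof
  let ?M = "mat m n (\<lambda>(i, j). M $$ (Suc i, Suc j))"
  have c: "M $$ (i, 0) = (if i = 0 then s else 0)" if "i < Suc m" for i
    using mult_unit_col[of M "Suc n" i 0] M that by (auto simp: col)
  have r: "M $$ (0, j) = 0" if "j < Suc n" "j \<noteq> 0" for j
    using mult_unit_col[of "adj M" "Suc m" j 0] M that by (auto simp: row)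
  show "M = block_diag (mat 1 1 (\<lambda>_. s)) ?M"
    using M c r by (intro eq_matI) (auto simp: block_diag_def)
qed simp

section \<open>Orthonormal columns and diagonalization over the complex numbers\<close>

lemma complex_norm_square_col:
  assumes "x \<in> carrier_mat n 1"
  shows "adj x * x = mat 1 1 (\<lambda>_. complex_of_real (\<Sum>i<n. (cmod (x $$ (i, 0)))\<^sup>2))"
  using assms
  by (intro eq_matI) (auto simp: scalar_prod_def complex_norm_square mult.commute lessThan_atLeast0 simp del: of_real_power intro!: sum.cong)

lemma normalize_col:
  assumes x: "x \<in> carrier_mat n 1" and "x \<noteq> 0\<^sub>m n 1"
  obtains c :: complex where "c \<noteq> 0" "adj (c \<cdot>\<^sub>m x) * (c \<cdot>\<^sub>m x) = 1\<^sub>m 1"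
proof -
  define r where "r = (\<Sum>i<n. (cmod (x $$ (i, 0)))\<^sup>2)"
  have "\<exists>i<n. x $$ (i, 0) \<noteq> 0"
    using assms by (metis carrier_matD eq_matI index_zero_mat less_one)
  then obtain i where "i < n" "x $$ (i, 0) \<noteq> 0" by auto
  hence "r > 0" unfolding r_def by (intro sum_pos2[of _ i]) auto
  define c where "c = complex_of_real (1 / sqrt r)"
  have "c * (cnj c * complex_of_real r) = complex_of_real (1 / sqrt r * (1 / sqrt r) * r)"
    by (simp only: c_def complex_cnj_complex_of_real of_real_mult mult.assoc)
  also have "1 / sqrt r * (1 / sqrt r) * r = 1" using \<open>r > 0\<close> by (simp add: field_simps)
  finally have "c * (cnj c * complex_of_real r) = 1" by simp
  hence "adj (c \<cdot>\<^sub>m x) * (c \<cdot>\<^sub>m x) = 1\<^sub>m 1"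
    using x complex_norm_square_col[OF x]
    by (simp add: adj_smult mult_smult_dim r_def[symmetric]) (auto intro!: eq_matI)
  moreover have "c \<noteq> 0" using \<open>r > 0\<close> by (simp add: c_def)
  ultimately show ?thesis using that by blast
qed

text \<open>The vector is extended to a basis and orthogonalized by Gram-Schmidt, which leaves the
  first basis vector untouched.\<close>

lemma complex_unitary_completion:
  assumes v: "v \<in> carrier_mat n 1" and unit: "adj v * v = 1\<^sub>m 1"
  shows "\<exists>U :: complex mat. unitary_mat n U \<and> U * unit_col n 0 = v"
proof -
  define w where "w = col v 0"
  have w: "w \<in> carrier_vec n" using v by (auto simp: w_def intro!: carrier_vecI)
  have ww: "w \<bullet>c w = 1"
    using arg_cong[OF unit, of "\<lambda>M. M $$ (0, 0)"] v
    by (simp add: w_def scalar_prod_def mult.commute)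
  hence w0: "w \<noteq> 0\<^sub>v n" using w by fastforce
  hence n: "n > 0" using w by (intro gr0I) auto
  interpret cof_vec_space n "TYPE(complex)" .
  define ws where "ws = gram_schmidt n (basis_completion w)"
  note bc = basis_completion[OF w w0]
  then obtain vs where bv: "basis_completion w = w # vs" using n by (cases "basis_completion w") auto
  from gram_schmidt_result[OF bc(2,4,5) refl, folded ws_def]
  have ws: "set ws \<subseteq> carrier_vec n" "corthogonal ws" "length ws = n"
    by (auto simp: bc(6))
  have hd: "ws ! 0 = w"
    using gram_schmidt_hd[OF w, of vs, folded bv] ws(3) n by (metis hd_conv_nth length_greater_0_conv ws_def)
  have dw: "ws ! i \<in> carrier_vec n" if "i < n" for i using ws that by auto
  \<comment> \<open>\<open>corthogonal\<close> gives orthogonality only, so the columns are divided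
    by their lengths \<open>s i\<close>. As \<open>s 0 = 1\<close>, the first column remains
    \<open>v\<close>.\<close>
  define s where "s i = complex_of_real (sqrt (Re (ws ! i \<bullet>c ws ! i)))" for i
  have s: "s i * s i = ws ! i \<bullet>c ws ! i" "s i \<noteq> 0" if "i < n" for i
  proof -
    have "ws ! i \<bullet>c ws ! i \<noteq> 0" using corthogonalD[OF ws(2), of i i] that ws(3) by simp
    hence "ws ! i \<bullet>c ws ! i > 0" using dw[OF that] by simp
    hence p: "Re (ws ! i \<bullet>c ws ! i) > 0" "Im (ws ! i \<bullet>c ws ! i) = 0" by (auto simp: less_complex_def)
    have "s i * s i = complex_of_real (Re (ws ! i \<bullet>c ws ! i))"
      unfolding s_def using p(1) by (simp flip: of_real_mult)
    thus "s i * s i = ws ! i \<bullet>c ws ! i" using p(2) by (simp add: complex_eq_iff)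
    show "s i \<noteq> 0" using p(1) by (simp add: s_def)
  qed
  define U where "U = mat n n (\<lambda>(i, j). ws ! j $ i / s j)"
  have U: "U \<in> carrier_mat n n" by (simp add: U_def)
  have "adj U * U = 1\<^sub>m n"
  proof (rule eq_matI)
    fix i j assume ij: "i < dim_row (1\<^sub>m n :: complex mat)" "j < dim_col (1\<^sub>m n :: complex mat)"
    have "(adj U * U) $$ (i, j) = (\<Sum>k = 0..<n. cnj (ws ! i $ k / s i) * (ws ! j $ k / s j))"
      using ij by (simp add: U_def scalar_prod_def)
    also have "\<dots> = (\<Sum>k = 0..<n. ws ! j $ k * cnj (ws ! i $ k)) / (s i * s j)"
      by (simp add: sum_divide_distrib s_def mult.commute)
    also have "(\<Sum>k = 0..<n. ws ! j $ k * cnj (ws ! i $ k)) = ws ! j \<bullet>c ws ! i"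
      using dw[of i] ij by (simp add: scalar_prod_def)
    finally show "(adj U * U) $$ (i, j) = 1\<^sub>m n $$ (i, j)"
      using ij s[of i] corthogonalD[OF ws(2), of j i] ws(3) by auto
  qed (simp_all add: U_def)
  moreover from this have "U * adj U = 1\<^sub>m n"
    by (rule mat_mult_left_right_inverse[OF adj_carrier[OF U] U])
  moreover have s0: "s 0 = 1" by (simp add: s_def hd ww)
  have "U * unit_col n 0 = v"
  proof (rule eq_matI)
    fix i j assume ij: "i < dim_row v" "j < dim_col v"
    hence "(U * unit_col n 0) $$ (i, 0) = ws ! 0 $ i / s 0"
      using n v by (subst mult_unit_col) (auto simp: U_def)
    thus "(U * unit_col n 0) $$ (i, j) = v $$ (i, j)"
      using ij v s0 by (simp add: hd) (simp add: w_def)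
  qed (use v in \<open>simp_all add: U_def\<close>)
  ultimately show ?thesis using U by (auto simp: unitary_mat_def)
qed

lemma complex_eigen_col:
  assumes A: "(A :: complex mat) \<in> carrier_mat n n" and n: "n > 0"
  obtains k v where "v \<in> carrier_mat n 1" "adj v * v = 1\<^sub>m 1" "A * v = k \<cdot>\<^sub>m v"
proof -
  from spectrum_non_empty[OF A n] obtain k w where "eigenvector A w k"
    by (auto simp: spectrum_def eigenvalue_def)
  hence w: "w \<in> carrier_vec n" "w \<noteq> 0\<^sub>v n" "A *\<^sub>v w = k \<cdot>\<^sub>v w"
    using A by (auto simp: eigenvector_def)
  define x where "x = mat n 1 (\<lambda>(i, j). w $ i)"
  have x: "x \<in> carrier_mat n 1" by (simp add: x_def)
  have "x \<noteq> 0\<^sub>m n 1"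
  proof
    assume z: "x = 0\<^sub>m n 1"
    have "w $ i = 0" if "i < n" for i
      using arg_cong[OF z, of "\<lambda>M. M $$ (i, 0)"] that by (simp add: x_def)
    thus False using w(1,2) by (auto intro!: eq_vecI)
  qed
  from normalize_col[OF x this] obtain c where c: "adj (c \<cdot>\<^sub>m x) * (c \<cdot>\<^sub>m x) = 1\<^sub>m 1" by blast
  have "col x 0 = w" using w(1) by (auto simp: x_def)
  have Ax: "A * x = k \<cdot>\<^sub>m x"
  proof (rule eq_matI)
    fix i j assume "i < dim_row (k \<cdot>\<^sub>m x)" "j < dim_col (k \<cdot>\<^sub>m x)"
    thus "(A * x) $$ (i, j) = (k \<cdot>\<^sub>m x) $$ (i, j)"
      using arg_cong[OF w(3), of "\<lambda>u. u $ i"] A w(1) \<open>col x 0 = w\<close> by (simp add: x_def)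
  qed (use A in \<open>auto simp: x_def\<close>)
  have "A * (c \<cdot>\<^sub>m x) = k \<cdot>\<^sub>m (c \<cdot>\<^sub>m x)"
    using A x by (simp add: mult_smult_dim Ax) (auto intro!: eq_matI)
  with c x that[of "c \<cdot>\<^sub>m x" k] show ?thesis by simp
qed

text \<open>In bases starting with \<open>v\<close> and \<open>u\<close>, the matrix becomes
  \<open>adj U * A * V\<close>, to which \<open>deflation\<close> applies. Singular pairs are the
  general case, eigenvectors of Hermitian matrices the case \<open>u = v\<close>.\<close>

lemma unitary_unit_col_deflation:
  fixes A :: "'a :: {comm_ring_1, conjugatable_ring} mat"
  assumes A: "A \<in> carrier_mat (Suc m) (Suc n)"
    and U: "unitary_mat (Suc m) U" "U * unit_col (Suc m) 0 = u"
    and V: "unitary_mat (Suc n) V" "V * unit_col (Suc n) 0 = v"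
    and Av: "A * v = s \<cdot>\<^sub>m u" and Au: "adj A * u = t \<cdot>\<^sub>m v"
  shows "\<exists>A' \<in> carrier_mat m n. A = U * block_diag (mat 1 1 (\<lambda>_. s)) A' * adj V"
proof -
  define M where "M = adj U * A * V"
  note u = unitary_matD[OF U(1)] and v = unitary_matD[OF V(1)]
  have dA: "dim_row A = Suc m" "dim_col A = Suc n" using A by auto
  have "M * unit_col (Suc n) 0 = adj U * (A * (V * unit_col (Suc n) 0))"
    using u v dA by (simp add: M_def mult_assoc_dim)
  also have "\<dots> = s \<cdot>\<^sub>m (adj U * (U * unit_col (Suc m) 0))"
    using u v dA by (simp add: V Av U(2)[symmetric] mult_smult_dim)
  finally have 1: "M * unit_col (Suc n) 0 = s \<cdot>\<^sub>m unit_col (Suc m) 0"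
    using u by simp
  have "adj M * unit_col (Suc m) 0 = adj V * (adj A * (U * unit_col (Suc m) 0))"
    using u v dA by (simp add: M_def mult_assoc_dim adj_mult)
  also have "\<dots> = t \<cdot>\<^sub>m (adj V * (V * unit_col (Suc n) 0))"
    using u v dA by (simp add: U Au V(2)[symmetric] mult_smult_dim)
  finally have 2: "adj M * unit_col (Suc m) 0 = t \<cdot>\<^sub>m unit_col (Suc n) 0"
    using v by simp
  have "M \<in> carrier_mat (Suc m) (Suc n)" using u v by (auto simp: M_def)
  from deflation[OF this 1 2] obtain A' where A': "A' \<in> carrier_mat m n"
    and M: "M = block_diag (mat 1 1 (\<lambda>_. s)) A'" by blast
  have "U * M * adj V = A * (V * adj V)"
    using u v dA by (simp add: M_def mult_assoc_dim)
  also have "\<dots> = A" using A by (simp add: v(4))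
  finally show ?thesis using A' M by auto
qed

lemma block_diag_diagonal:
  assumes "diagonal_mat A" "diagonal_mat B" "A \<in> carrier_mat m m"
  shows "diagonal_mat (block_diag A B)"
  using assms by (auto simp: diagonal_mat_def block_diag_def)

text \<open>Since \<open>adj H = H\<close>, a single eigenvector supplies both the column and the
  row condition for deflation, and the remaining block is again Hermitian.\<close>

lemma hermitian_spectral:
  assumes "H \<in> carrier_mat n n" "adj H = (H :: complex mat)"
  shows "\<exists>U D. unitary_mat n U \<and> D \<in> carrier_mat n n \<and> diagonal_mat D \<and> H = U * D * adj U"
  using assms
proof (induction n arbitrary: H)
  case 0
  show ?case
    by (rule exI[of _ "1\<^sub>m 0"], rule exI[of _ H])
      (use 0 in \<open>auto simp: unitary_mat_def diagonal_mat_def intro!: eq_matI\<close>)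
next
  case (Suc n)
  obtain k v where v: "v \<in> carrier_mat (Suc n) 1" "adj v * v = 1\<^sub>m 1" "H * v = k \<cdot>\<^sub>m v"
    using complex_eigen_col[OF Suc.prems(1)] by blast
  obtain U where U: "unitary_mat (Suc n) U" "U * unit_col (Suc n) 0 = v"
    using complex_unitary_completion[OF v(1,2)] by blast
  have "adj H * v = k \<cdot>\<^sub>m v" using v(3) Suc.prems(2) by simp
  from unitary_unit_col_deflation[OF Suc.prems(1) U U v(3) this]
  obtain H' where H': "H' \<in> carrier_mat n n"
    and H: "H = U * block_diag (mat 1 1 (\<lambda>_. k)) H' * adj U" by blast
  note u = unitary_matD[OF U(1)]
  have "block_diag (mat 1 1 (\<lambda>_. k)) H' = adj U * H * U"
    using u H' by (simp add: H mult_assoc_dim)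
  moreover have "adj (adj U * H * U) = adj U * H * U"
    using u Suc.prems by (simp add: adj_mult mult_assoc_dim)
  ultimately have B: "adj (block_diag (mat 1 1 (\<lambda>_. k)) H') = block_diag (mat 1 1 (\<lambda>_. k)) H'" by simp
  have "adj H' = H'"
  proof (rule eq_matI)
    fix i j assume "i < dim_row H'" "j < dim_col H'"
    thus "adj H' $$ (i, j) = H' $$ (i, j)"
      using arg_cong[OF B, of "\<lambda>M. M $$ (Suc i, Suc j)"] H' by (simp add: block_diag_def)
  qed (use H' in auto)
  from Suc.IH[OF H' this] obtain W D where W: "unitary_mat n W" and D: "D \<in> carrier_mat n n" "diagonal_mat D"
    and H'D: "H' = W * D * adj W" by blast
  note w = unitary_matD[OF W]
  have "H = (U * block_diag (1\<^sub>m 1) W) * block_diag (mat 1 1 (\<lambda>_. k)) D * adj (U * block_diag (1\<^sub>m 1) W)"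
    using block_diag_deflate[OF H[unfolded H'D]] u w D by simp
  moreover have "unitary_mat (Suc n) (U * block_diag (1\<^sub>m 1) W)"
    using unitary_mat_mult[OF U(1)] unitary_block_diag[OF unitary_mat_one[of 1] W] by simp
  moreover have "block_diag (mat 1 1 (\<lambda>_. k)) D \<in> carrier_mat (Suc n) (Suc n)" using D by auto
  moreover have "diagonal_mat (block_diag (mat 1 1 (\<lambda>_. k)) D)"
    by (rule block_diag_diagonal[of _ _ 1]) (use D in \<open>auto simp: diagonal_mat_def\<close>)
  ultimately show ?case by blast
qed

section \<open>Dual complex singular value decomposition\<close>

lemma smult_smult_mat: "a \<cdot>\<^sub>m (b \<cdot>\<^sub>m A) = (a * b) \<cdot>\<^sub>m (A :: 'a :: comm_ring_1 mat)"
  by (rule eq_matI) (auto simp: mult.assoc)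

lemma distrib_dim:
  fixes A B C :: "'a :: comm_ring_1 mat"
  assumes "dim_row A = dim_row B" "dim_col A = dim_col B"
  shows "dim_col A = dim_row C \<Longrightarrow> (A + B) * C = A * C + B * C"
    and "dim_col C = dim_row A \<Longrightarrow> C * (A + B) = C * A + C * B"
  using assms by (auto intro!: add_mult_distrib_mat mult_add_distrib_mat)

lemma diagonal_mult_index:
  fixes D M :: "'a :: comm_ring_1 mat"
  assumes "diagonal_mat D" "D \<in> carrier_mat n n" "dim_row M = n" "i < n" "j < dim_col M"
  shows "(D * M) $$ (i, j) = D $$ (i, i) * M $$ (i, j)"
proof -
  have "(D * M) $$ (i, j) = (\<Sum>k = 0..<n. D $$ (i, k) * M $$ (k, j))"
    using assms by (simp add: scalar_prod_def)
  also have "\<dots> = (\<Sum>k = 0..<n. if k = i then D $$ (i, i) * M $$ (i, j) else 0)"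
    using assms by (intro sum.cong) (auto simp: diagonal_mat_def)
  finally show ?thesis using assms by simp
qed

text \<open>No orthogonalization is carried out over the dual complex numbers: a complex completion
  \<open>W\<close> of the standard part is corrected to first order.\<close>

lemma dual_unitary_completion:
  fixes v :: "dual_complex mat"
  assumes v: "v \<in> carrier_mat n 1" and unit: "adj v * v = 1\<^sub>m 1"
  shows "\<exists>U. unitary_mat n U \<and> U * unit_col n 0 = v"
proof (cases "n = 0")
  case True
  thus ?thesis using v by (intro exI[of _ "1\<^sub>m 0"]) (auto simp: unitary_mat_one intro!: eq_matI)
next
  case False
  define x where "x = std_mat v"
  define y where "y = inf_mat v"
  have d: "dim_row v = n" "dim_col v = 1" "dim_row x = n" "dim_col x = 1" "dim_row y = n" "dim_col y = 1"
    using v by (auto simp: x_def y_def)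
  have xx: "adj x * x = 1\<^sub>m 1" using arg_cong[OF unit, of std_mat] d by (simp add: std_mat_mult x_def)
  have xy: "adj x * y + adj y * x = 0\<^sub>m 1 1"
    using arg_cong[OF unit, of inf_mat] d by (simp add: inf_mat_mult x_def y_def)
  obtain W where W: "unitary_mat n W" "W * unit_col n 0 = x"
    using complex_unitary_completion[OF _ xx] d by auto
  note w = unitary_matD[OF W(1)]
  \<comment> \<open>The coordinates of the infinitesimal part of \<open>v\<close> in the basis
    \<open>W\<close>.\<close>
  define k where "k = adj W * y"
  have dk: "dim_row k = n" "dim_col k = 1" using w d by (auto simp: k_def)
  have "adj k * unit_col n 0 = adj y * x"
    using w d by (simp add: k_def adj_mult mult_assoc_dim W(2))
  hence yx: "(adj y * x) $$ (0, 0) = cnj (k $$ (0, 0))"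
    using mult_unit_col[of "adj k" n 0 0] dk False by simp
  have "(adj x * y) $$ (0, 0) = adj (adj y * x) $$ (0, 0)" using d by (simp add: adj_mult)
  also have "\<dots> = k $$ (0, 0)" using d yx by simp
  finally have k0: "k $$ (0, 0) + cnj (k $$ (0, 0)) = 0"
    using arg_cong[OF xy, of "\<lambda>M. M $$ (0, 0)"] yx d by simp
  \<comment> \<open>$W(I + \epsilon K)$ is unitary iff $K$ is skew-Hermitian, and its first column is $v$ iff that of
    $K$ is $k$; the unit length of $v$ makes $k_0$ purely imaginary.\<close>
  define K where "K = mat n n (\<lambda>(i, j). if j = 0 then k $$ (i, 0) else if i = 0 then - cnj (k $$ (j, 0)) else 0)"
  have dK: "dim_row K = n" "dim_col K = n" by (simp_all add: K_def)
  have skew: "K + adj K = 0\<^sub>m n n" "adj K + K = 0\<^sub>m n n"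
    using k0 by (auto intro!: eq_matI simp: K_def add.commute)
  have Ke: "K * unit_col n 0 = k"
  proof (rule eq_matI)
    fix i j assume "i < dim_row k" "j < dim_col k"
    thus "(K * unit_col n 0) $$ (i, j) = k $$ (i, j)"
      using mult_unit_col[of K n i 0] dk False by (simp add: K_def)
  qed (simp_all add: dk dK)
  define U where "U = dual_mat W (W * K)"
  have dU: "dim_row U = n" "dim_col U = n" by (simp_all add: U_def w)
  have sU: "std_mat U = W" and iU: "inf_mat U = W * K" by (simp_all add: U_def w dK)
  have "adj U * U = 1\<^sub>m n"
    by (rule dual_mat_eqI)
      (simp_all add: std_mat_mult inf_mat_mult dU sU iU w dK adj_mult mult_assoc_dim skew)
  moreover have "U * adj U = 1\<^sub>m n"
  proof (rule dual_mat_eqI)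
    have "inf_mat (U * adj U) = W * ((adj K + K) * adj W)"
      by (simp add: inf_mat_mult dU sU iU w dK adj_mult mult_assoc_dim distrib_dim)
    thus "inf_mat (U * adj U) = inf_mat (1\<^sub>m n)" by (simp add: skew w)
  qed (simp add: std_mat_mult dU sU w)
  moreover have "U * unit_col n 0 = v"
  proof (rule dual_mat_eqI)
    have e: "std_mat (unit_col n 0) = unit_col n 0" "inf_mat (unit_col n 0) = 0\<^sub>m n 1"
      by (auto simp: unit_col_def intro!: eq_matI)
    show "std_mat (U * unit_col n 0) = std_mat v"
      by (simp add: std_mat_mult dU sU e W(2)) (simp add: x_def)
    have "inf_mat (U * unit_col n 0) = W * (K * unit_col n 0)"
      using left_add_zero_mat[of "W * k" n 1] w dk
      by (auto simp: inf_mat_mult dU sU iU e dK mult_assoc_dim Ke intro!: carrier_matI)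
    also have "\<dots> = y" by (simp add: Ke k_def w d)
    finally show "inf_mat (U * unit_col n 0) = inf_mat v" by (simp add: y_def)
  qed
  ultimately show ?thesis using dU by (auto simp: unitary_mat_def intro!: carrier_matI)
qed

text \<open>A nonzero \<open>H\<close> leaves a nonzero entry on the diagonal of \<open>D\<close>,
  and \<open>D = adj U * H * U\<close> is Hermitian, so that entry is real. That the eigenvalue can
  be chosen nonzero is what later makes singular values appreciable and confines an eigenvector to a
  coordinate subspace.\<close>

lemma hermitian_nonzero_eigenvalue:
  assumes H: "H \<in> carrier_mat n n" "adj H = (H :: complex mat)" "H \<noteq> 0\<^sub>m n n"
  obtains k :: real and x where "k \<noteq> 0" "x \<in> carrier_mat n 1" "adj x * x = 1\<^sub>m 1"
    "H * x = complex_of_real k \<cdot>\<^sub>m x"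
proof -
  obtain U D where U: "unitary_mat n U" and D: "D \<in> carrier_mat n n" "diagonal_mat D"
    and HD: "H = U * D * adj U" using hermitian_spectral[OF H(1,2)] by blast
  note u = unitary_matD[OF U]
  have dD: "dim_row D = n" "dim_col D = n" using D by auto
  have "D * (adj U * U) = D" by (simp add: u(3)) (use D in simp)
  hence DH: "D = adj U * H * U"
    using u dD by (simp add: HD mult_assoc_dim)
  hence Dh: "adj D = D" using u H by (simp add: adj_mult mult_assoc_dim)
  have "D \<noteq> 0\<^sub>m n n" using H(3) u by (auto simp: HD)
  then obtain i j where "i < n" "j < n" "D $$ (i, j) \<noteq> 0"
    using dD by (metis eq_matI index_zero_mat)
  with D(2) dD have i: "i < n" "D $$ (i, i) \<noteq> 0" by (auto simp: diagonal_mat_def)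
  define k where "k = Re (D $$ (i, i))"
  have "cnj (D $$ (i, i)) = D $$ (i, i)" using arg_cong[OF Dh, of "\<lambda>M. M $$ (i, i)"] i dD by simp
  hence k: "D $$ (i, i) = complex_of_real k" by (simp add: k_def complex_eq_iff)
  define e :: "complex mat" where "e = unit_col n i"
  have de: "dim_row e = n" "dim_col e = 1" by (simp_all add: e_def)
  have ee: "adj e * e = 1\<^sub>m 1"
  proof (rule eq_matI)
    fix a b assume "a < dim_row (1\<^sub>m 1 :: complex mat)" "b < dim_col (1\<^sub>m 1 :: complex mat)"
    thus "(adj e * e) $$ (a, b) = 1\<^sub>m 1 $$ (a, b)"
      using mult_unit_col[of "adj e" n 0 i] i by (simp add: e_def)
  qed (simp_all add: de)
  have De: "D * e = complex_of_real k \<cdot>\<^sub>m e"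
  proof (rule eq_matI)
    fix a b assume ab: "a < dim_row (complex_of_real k \<cdot>\<^sub>m e)" "b < dim_col (complex_of_real k \<cdot>\<^sub>m e)"
    hence "(D * e) $$ (a, 0) = D $$ (a, a) * e $$ (a, 0)"
      by (intro diagonal_mult_index[OF D(2,1)]) (simp_all add: de)
    thus "(D * e) $$ (a, b) = (complex_of_real k \<cdot>\<^sub>m e) $$ (a, b)"
      using ab by (auto simp: de k[symmetric]) (auto simp: e_def)
  qed (simp_all add: de dD)
  show ?thesis
  proof (rule that)
    show "k \<noteq> 0" using k i by auto
    show "U * e \<in> carrier_mat n 1" using u de by auto
    show "adj (U * e) * (U * e) = 1\<^sub>m 1" using u de ee by (simp add: adj_mult mult_assoc_dim)
    show "H * (U * e) = complex_of_real k \<cdot>\<^sub>m (U * e)"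
      using u de dD by (simp add: HD mult_assoc_dim De mult_smult_dim)
  qed
qed

text \<open>Degenerate first-order perturbation theory. In an eigenbasis \<open>U\<close> of the
  standard part, \<open>x + y eps\<close> is an eigenvector for \<open>l + k eps\<close> iff
  \<open>(D - l) x = 0\<close> and \<open>(D - l) y = (k - G) x\<close>. The first equation confines
  \<open>x\<close> to the coordinates in \<open>J\<close>. There the second becomes an eigenvalue
  problem for the compressed \<open>G\<close>; elsewhere it determines \<open>y\<close>.\<close>

lemma dual_hermitian_eigenvector:
  fixes H :: "dual_complex mat"
  assumes H: "H \<in> carrier_mat n n" "adj H = H"
    and z: "z \<in> carrier_mat n 1" "z \<noteq> 0\<^sub>m n 1" "std_mat H * z = complex_of_real l \<cdot>\<^sub>m z"
  obtains v and k :: real where "v \<in> carrier_mat n 1" "adj v * v = 1\<^sub>m 1"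
    "H * v = DC (complex_of_real l) (complex_of_real k) \<cdot>\<^sub>m v"
proof -
  define l' where "l' = complex_of_real l"
  have dH: "dim_row H = n" "dim_col H = n" using H by auto
  have dz: "dim_row z = n" "dim_col z = 1" using z by auto
  have "adj (std_mat H) = std_mat H" "adj (inf_mat H) = inf_mat H"
    using H(2) by (simp_all flip: std_mat_simps inf_mat_simps)
  with hermitian_spectral[of "std_mat H" n] dH obtain U D where U: "unitary_mat n U"
    and D: "D \<in> carrier_mat n n" "diagonal_mat D" and HD: "std_mat H = U * D * adj U"
    by (metis carrier_mat_triv dim_dual_parts(1,2))
  note u = unitary_matD[OF U]
  have dD: "dim_row D = n" "dim_col D = n" using D by auto
  have Hi: "adj (inf_mat H) = inf_mat H" by fact
  define J where "J = {i. i < n \<and> D $$ (i, i) = l'}"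
  \<comment> \<open>Some coordinate of \<open>z\<close> in the eigenbasis is nonzero; its index lies
    in \<open>J\<close>.\<close>
  have "\<exists>i. i \<in> J"
  proof -
    define w where "w = adj U * z"
    have dw: "dim_row w = n" "dim_col w = 1" using u dz by (auto simp: w_def)
    have "D * w = adj U * (std_mat H * z)" using u dz dD by (simp add: w_def HD mult_assoc_dim)
    also have "\<dots> = l' \<cdot>\<^sub>m w" using u dz by (simp add: z(3) w_def l'_def mult_smult_dim)
    finally have Dw: "D * w = l' \<cdot>\<^sub>m w" .
    have "z = U * w" using u dz by (simp add: w_def)
    hence "w \<noteq> 0\<^sub>m n 1" using z(2) u by auto
    then obtain i where i: "i < n" "w $$ (i, 0) \<noteq> 0" using dw
      by (metis eq_matI index_zero_mat less_one)
    hence "D $$ (i, i) * w $$ (i, 0) = l' * w $$ (i, 0)"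
      using diagonal_mult_index[OF D(2,1), of w i 0] arg_cong[OF Dw, of "\<lambda>M. M $$ (i, 0)"] dw by simp
    thus ?thesis using i by (auto simp: J_def)
  qed
  then obtain i0 where i0: "i0 \<in> J" by blast
  define G where "G = adj U * inf_mat H * U"
  have dG: "dim_row G = n" "dim_col G = n" using u by (auto simp: G_def)
  have Gh: "adj G = G" using u dH Hi by (simp add: G_def adj_mult mult_assoc_dim)
  \<comment> \<open>Compressing $G$ to the eigenspace picks the directions $x$ for which
    $(D - l)y = (k - G)x$ is solvable.\<close>
  define C where "C = mat n n (\<lambda>(i, j). if i \<in> J \<and> j \<in> J then G $$ (i, j) else 0)"
  have dC: "C \<in> carrier_mat n n" by (simp add: C_def)
  have Ch: "adj C = C"
  proof (rule eq_matI)
    fix i j assume ij: "i < dim_row C" "j < dim_col C"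
    thus "adj C $$ (i, j) = C $$ (i, j)"
      using arg_cong[OF Gh, of "\<lambda>M. M $$ (i, j)"] dG by (auto simp: C_def)
  qed (simp_all add: C_def)
  have C0: "(C * x) $$ (i, 0) = 0" if "i < n" "i \<notin> J" "dim_row x = n" "dim_col x = 1" for x i
    using that by (simp add: C_def scalar_prod_def)
  \<comment> \<open>If \<open>C\<close> vanishes, any basis vector from \<open>J\<close> serves with
    \<open>k = 0\<close>. Otherwise a nonzero eigenvalue is chosen: \<open>C * x\<close> vanishes
    outside \<open>J\<close>, hence so does \<open>x\<close>.\<close>
  obtain k :: real and x where x: "x \<in> carrier_mat n 1" "adj x * x = 1\<^sub>m 1"
    and Cx: "C * x = complex_of_real k \<cdot>\<^sub>m x" and xJ: "\<And>i. i < n \<Longrightarrow> i \<notin> J \<Longrightarrow> x $$ (i, 0) = 0"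
  proof (cases "C = 0\<^sub>m n n")
    case True
    have i0': "i0 < n" using i0 by (simp add: J_def)
    define e :: "complex mat" where "e = unit_col n i0"
    show ?thesis
    proof (rule that)
      show "e \<in> carrier_mat n 1" by (simp add: e_def carrier_matI)
      show "adj e * e = 1\<^sub>m 1"
      proof (rule eq_matI)
        fix a b assume "a < dim_row (1\<^sub>m 1 :: complex mat)" "b < dim_col (1\<^sub>m 1 :: complex mat)"
        thus "(adj e * e) $$ (a, b) = 1\<^sub>m 1 $$ (a, b)"
          using mult_unit_col[of "adj e" n 0 i0] i0' by (simp add: e_def)
      qed (simp_all add: e_def)
      show "C * e = complex_of_real 0 \<cdot>\<^sub>m e" by (auto simp: True e_def intro!: eq_matI)
      show "e $$ (i, 0) = 0" if "i < n" "i \<notin> J" for i using that i0 by (auto simp: e_def)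
    qed
  next
    case False
    from hermitian_nonzero_eigenvalue[OF dC Ch this] obtain k x where
      x: "k \<noteq> 0" "x \<in> carrier_mat n 1" "adj x * x = 1\<^sub>m 1" "C * x = complex_of_real k \<cdot>\<^sub>m x" by blast
    have "x $$ (i, 0) = 0" if "i < n" "i \<notin> J" for i
      using C0[OF that, of x] x that carrier_matD[OF x(2)] by simp
    with x that show ?thesis by blast
  qed
  have dx: "dim_row x = n" "dim_col x = 1" using x by auto
  \<comment> \<open>Outside \<open>J\<close> this solves the equation by division; the value 0 on
    \<open>J\<close> makes \<open>y\<close> orthogonal to \<open>x\<close>, so that \<open>v\<close>
    keeps unit length.\<close>
  define y where "y = mat n 1 (\<lambda>(i, j). if i \<in> J then 0 else - ((G * x) $$ (i, 0)) / (D $$ (i, i) - l'))"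
  have dy: "dim_row y = n" "dim_col y = 1" by (simp_all add: y_def)
  have CG: "(C * x) $$ (i, 0) = (G * x) $$ (i, 0)" if "i \<in> J" for i
    using that dG dx xJ by (auto simp: C_def J_def scalar_prod_def intro!: sum.cong)
  have Dx: "D * x = l' \<cdot>\<^sub>m x"
  proof (rule eq_matI)
    fix i j assume "i < dim_row (l' \<cdot>\<^sub>m x)" "j < dim_col (l' \<cdot>\<^sub>m x)"
    thus "(D * x) $$ (i, j) = (l' \<cdot>\<^sub>m x) $$ (i, j)"
      using diagonal_mult_index[OF D(2,1), of x i 0] dx xJ[of i] by (auto simp: J_def)
  qed (simp_all add: dx dD)
  have DG: "D * y + G * x = l' \<cdot>\<^sub>m y + complex_of_real k \<cdot>\<^sub>m x"
  proof (rule eq_matI)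
    fix i j assume "i < dim_row (l' \<cdot>\<^sub>m y + complex_of_real k \<cdot>\<^sub>m x)" "j < dim_col (l' \<cdot>\<^sub>m y + complex_of_real k \<cdot>\<^sub>m x)"
    hence i: "i < n" and j: "j = 0" by (simp_all add: dx)
    have Dy: "(D * y) $$ (i, 0) = D $$ (i, i) * y $$ (i, 0)"
      using diagonal_mult_index[OF D(2,1), of y i 0] dy i by simp
    have L: "(D * y + G * x) $$ (i, j) = (D * y) $$ (i, 0) + (G * x) $$ (i, 0)"
      unfolding j by (rule index_add_mat) (simp_all add: dG dx i)
    have R: "(l' \<cdot>\<^sub>m y + complex_of_real k \<cdot>\<^sub>m x) $$ (i, j) = l' * y $$ (i, 0) + complex_of_real k * x $$ (i, 0)"
      using i j dx dy by simp
    show "(D * y + G * x) $$ (i, j) = (l' \<cdot>\<^sub>m y + complex_of_real k \<cdot>\<^sub>m x) $$ (i, j)"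
    proof (cases "i \<in> J")
      case True
      have "(G * x) $$ (i, 0) = complex_of_real k * x $$ (i, 0)"
        using CG[OF True] arg_cong[OF Cx, of "\<lambda>M. M $$ (i, 0)"] i dx by simp
      thus ?thesis unfolding L R Dy using True by (simp add: y_def i J_def)
    next
      case False
      hence "D $$ (i, i) - l' \<noteq> 0" using i by (auto simp: J_def)
      moreover have "y $$ (i, 0) = - ((G * x) $$ (i, 0)) / (D $$ (i, i) - l')" using False i by (simp add: y_def)
      ultimately have "y $$ (i, 0) * (D $$ (i, i) - l') = - (G * x) $$ (i, 0)" by simp
      thus ?thesis unfolding L R Dy xJ[OF i False] by (simp add: algebra_simps)
    qed
  qed (simp_all add: dx dG dy dD)
  define v where "v = dual_mat (U * x) (U * y)"
  have dv: "dim_row v = n" "dim_col v = 1" using u dx by (simp_all add: v_def)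
  have sv: "std_mat v = U * x" and iv: "inf_mat v = U * y" using u dx dy by (simp_all add: v_def)
  have xy: "adj x * y = 0\<^sub>m 1 1" "adj y * x = 0\<^sub>m 1 1"
  proof -
    have "cnj (x $$ (i, 0)) * y $$ (i, 0) = 0" "cnj (y $$ (i, 0)) * x $$ (i, 0) = 0" if "i < n" for i
      using xJ[OF that] that by (auto simp: y_def)
    thus "adj x * y = 0\<^sub>m 1 1" "adj y * x = 0\<^sub>m 1 1"
      using dx dy by (auto intro!: eq_matI sum.neutral simp: scalar_prod_def)
  qed
  show ?thesis
  proof (rule that)
    show "v \<in> carrier_mat n 1" using dv by auto
    show "adj v * v = 1\<^sub>m 1"
    proof (rule dual_mat_eqI)
      show "std_mat (adj v * v) = std_mat (1\<^sub>m 1)"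
        using u dx x dv by (simp add: std_mat_mult sv adj_mult mult_assoc_dim)
      show "inf_mat (adj v * v) = inf_mat (1\<^sub>m 1)"
        using u dx dy xy dv by (simp add: inf_mat_mult sv iv adj_mult mult_assoc_dim)
    qed
    show "H * v = DC (complex_of_real l) (complex_of_real k) \<cdot>\<^sub>m v"
    proof (rule dual_mat_eqI)
      show "std_mat (H * v) = std_mat (DC (complex_of_real l) (complex_of_real k) \<cdot>\<^sub>m v)"
        using u dx dv dH dD
        by (simp add: std_mat_mult sv HD mult_assoc_dim Dx mult_smult_dim l'_def)
      have 1: "inf_mat H * (U * x) = U * (G * x)"
        using u dH dx by (simp add: G_def mult_assoc_dim)
      have 2: "std_mat H * (U * y) = U * (D * y)"
        using u dy dD by (simp add: HD mult_assoc_dim)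
      have "inf_mat (H * v) = U * (D * y + G * x)"
        using u dv dH dD dy dG dx by (simp add: inf_mat_mult sv iv 1 2 distrib_dim)
      also have "\<dots> = U * (l' \<cdot>\<^sub>m y + complex_of_real k \<cdot>\<^sub>m x)" by (simp only: DG)
      also have "\<dots> = l' \<cdot>\<^sub>m (U * y) + complex_of_real k \<cdot>\<^sub>m (U * x)"
        using u dx dy by (simp add: distrib_dim mult_smult_dim)
      finally show "inf_mat (H * v) = inf_mat (DC (complex_of_real l) (complex_of_real k) \<cdot>\<^sub>m v)"
        by (simp add: sv iv l'_def)
    qed
  qed
qed

text \<open>A unit eigenvector \<open>v\<close> of \<open>adj A * A\<close> with eigenvalue
  \<open>s * s\<close> gives the left singular vector \<open>u\<close> as \<open>A * v\<close>
  divided by \<open>s\<close>; this division is possible because the standard part of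
  \<open>s\<close> is positive.\<close>

lemma appreciable_singular_pair:
  fixes A :: "dual_complex mat"
  assumes A: "A \<in> carrier_mat m n" and nz: "std_mat A \<noteq> 0\<^sub>m m n"
  obtains u v s where "u \<in> carrier_mat m 1" "adj u * u = 1\<^sub>m 1" "v \<in> carrier_mat n 1" "adj v * v = 1\<^sub>m 1"
    "positive_appreciable s" "A * v = s \<cdot>\<^sub>m u" "adj A * u = s \<cdot>\<^sub>m v"
proof -
  have dA: "dim_row A = m" "dim_col A = n" using A by auto
  define S where "S = std_mat A"
  have dS: "dim_row S = m" "dim_col S = n" by (simp_all add: S_def dA)
  \<comment> \<open>The diagonal entries of \<open>adj S * S\<close> are the squared norms of the
    columns of \<open>S\<close>.\<close>
  have nzS: "adj S * S \<noteq> 0\<^sub>m n n"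
  proof
    assume z: "adj S * S = 0\<^sub>m n n"
    have "S $$ (i, j) = 0" if "i < m" "j < n" for i j
    proof -
      have "(\<Sum>k = 0..<m. (cmod (S $$ (k, j)))\<^sup>2) = 0"
      proof -
        have "complex_of_real (\<Sum>k = 0..<m. (cmod (S $$ (k, j)))\<^sup>2) = (adj S * S) $$ (j, j)"
          using that dS
          by (simp add: scalar_prod_def complex_norm_square mult.commute del: of_real_power)
        also have "\<dots> = 0" using z that by simp
        finally show ?thesis by (simp only: of_real_eq_0_iff)
      qed
      thus ?thesis using that by (subst (asm) sum_nonneg_eq_0_iff) auto
    qed
    hence "S = 0\<^sub>m m n" by (intro eq_matI) (auto simp: dS)
    thus False using nz by (simp add: S_def)
  qed
  from hermitian_nonzero_eigenvalue[of "adj S * S" n] nzS obtain l z where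
    z: "l \<noteq> 0" "z \<in> carrier_mat n 1" "adj z * z = 1\<^sub>m 1" "adj S * S * z = complex_of_real l \<cdot>\<^sub>m z"
    using dS by (metis adj_adj adj_mult carrier_matI dim_adj(1,2) index_mult_mat(2,3))
  have dz: "dim_row z = n" "dim_col z = 1" using z by auto
  have "l > 0"
  proof -
    have "adj z * (adj S * S * z) = adj (S * z) * (S * z)" using dz dS by (simp add: adj_mult mult_assoc_dim)
    moreover have "adj z * (adj S * S * z) = complex_of_real l \<cdot>\<^sub>m (adj z * z)"
      unfolding z(4) using dz by (simp add: mult_smult_dim)
    moreover have "S * z \<in> carrier_mat m 1" using dS dz by auto
    ultimately have "complex_of_real l = complex_of_real (\<Sum>i<m. (cmod ((S * z) $$ (i, 0)))\<^sup>2)"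
      using complex_norm_square_col[of "S * z" m] z(3)
      by (metis (no_types, lifting) index_mat(1) index_one_mat(1) index_smult_mat(1) less_one
          mult.right_neutral prod.simps(2) dim_row_mat(1) dim_col_mat(1) index_one_mat(2,3))
    hence "l = (\<Sum>i<m. (cmod ((S * z) $$ (i, 0)))\<^sup>2)" by (simp only: of_real_eq_iff)
    hence "l \<ge> 0" by (simp add: sum_nonneg)
    with z(1) show ?thesis by simp
  qed
  define H where "H = adj A * A"
  have dH: "H \<in> carrier_mat n n" by (auto simp: H_def dA)
  have Hh: "adj H = H" by (simp add: H_def adj_mult)
  have sH: "std_mat H = adj S * S" by (simp add: H_def std_mat_mult S_def)
  have z0: "z \<noteq> 0\<^sub>m n 1"
  proof
    assume "z = 0\<^sub>m n 1"
    hence "adj z * z = 0\<^sub>m 1 1" by simp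
    hence "(1\<^sub>m 1 :: complex mat) $$ (0, 0) = 0\<^sub>m 1 1 $$ (0, 0)" using z(3) by simp
    thus False by simp
  qed
  obtain v and k :: real where v: "v \<in> carrier_mat n 1" "adj v * v = 1\<^sub>m 1"
    "H * v = DC (complex_of_real l) (complex_of_real k) \<cdot>\<^sub>m v"
    using dual_hermitian_eigenvector[OF dH Hh z(2) z0] z(4) sH by metis
  have dv: "dim_row v = n" "dim_col v = 1" using v by auto
  define r where "r = sqrt l"
  have r: "r > 0" "r * r = l" using \<open>l > 0\<close> by (auto simp: r_def)
  \<comment> \<open>\<open>s\<close> is the square root of \<open>l + k eps\<close>, expanded to
    first order at \<open>l = r * r\<close>, and \<open>t\<close> is its inverse.\<close>
  define s where "s = DC (complex_of_real r) (complex_of_real (k / (2 * r)))"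
  define t where "t = DC (complex_of_real (1 / r)) (complex_of_real (- k / (2 * r * r * r)))"
  have ss: "s * s = DC (complex_of_real l) (complex_of_real k)"
  proof -
    have "r * (k / (2 * r)) + k / (2 * r) * r = k" using r(1) by (simp add: field_simps)
    thus ?thesis
      unfolding s_def times_dual_complex_def dual_complex.sel
      by (simp only: of_real_mult[symmetric] of_real_add[symmetric] r(2))
  qed
  have st: "s * t = 1" "t * s = 1"
    using r by (simp_all add: s_def t_def dual_complex_eq_iff field_simps)
  have ct: "conjugate t = t" by (simp add: t_def conjugate_dual_complex_def)
  have Hv: "adj A * (A * v) = (s * s) \<cdot>\<^sub>m v" using v(3) dA dv by (simp add: H_def mult_assoc_dim ss)
  define u where "u = t \<cdot>\<^sub>m (A * v)"
  show ?thesis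
  proof (rule that)
    show "u \<in> carrier_mat m 1" using dA dv by (auto simp: u_def)
    show "v \<in> carrier_mat n 1" "adj v * v = 1\<^sub>m 1" by fact+
    show "positive_appreciable s" using r by (simp add: positive_appreciable_def is_dual_number_def s_def)
    show "A * v = s \<cdot>\<^sub>m u" by (auto simp: u_def smult_smult_mat st intro!: eq_matI)
    show "adj A * u = s \<cdot>\<^sub>m v"
      using dA dv st by (simp add: u_def mult_smult_dim Hv smult_smult_mat mult.assoc[symmetric])
    have "adj u * u = (t * (t * (s * s))) \<cdot>\<^sub>m (adj v * v)"
      using dA dv by (simp add: u_def adj_smult ct mult_smult_dim adj_mult mult_assoc_dim Hv smult_smult_mat)
    also have "t * (t * (s * s)) = (t * s) * (t * s)" by (simp only: ac_simps)
    finally show "adj u * u = 1\<^sub>m 1" by (simp add: st v(2)) (auto intro!: eq_matI)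
  qed
qed

section \<open>Assembling the singular value decomposition\<close>

lemma block_diag_empty: "block_diag (0\<^sub>m 0 0) A = A"
  by (rule eq_matI) (auto simp: block_diag_def)

text \<open>Each round splits off one appreciable singular value. It stops with \<open>r = 0\<close>
  and \<open>A\<close> itself as remainder once there are no rows or the standard part
  vanishes.\<close>

lemma appreciable_svd:
  fixes A :: "dual_complex mat"
  assumes "A \<in> carrier_mat m n"
  shows "\<exists>r U S R V. r \<le> m \<and> r \<le> n \<and> unitary_mat m U \<and> unitary_mat n V \<and>
    S \<in> carrier_mat r r \<and> diagonal_mat S \<and> (\<forall>i<r. positive_appreciable (S $$ (i, i))) \<and>
    R \<in> carrier_mat (m - r) (n - r) \<and> std_mat R = 0\<^sub>m (m - r) (n - r) \<and>
    A = U * block_diag S R * adj V"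
  using assms
proof (induction m arbitrary: n A)
  case 0
  show ?case
    by (rule exI[of _ 0], rule exI[of _ "1\<^sub>m 0"], rule exI[of _ "0\<^sub>m 0 0"], rule exI[of _ A],
        rule exI[of _ "1\<^sub>m n"])
      (use 0 in \<open>auto simp: unitary_mat_one block_diag_empty diagonal_mat_def intro!: eq_matI\<close>)
next
  case (Suc m)
  show ?case
  proof (cases "std_mat A = 0\<^sub>m (Suc m) n")
    case True
    show ?thesis
      by (rule exI[of _ 0], rule exI[of _ "1\<^sub>m (Suc m)"], rule exI[of _ "0\<^sub>m 0 0"], rule exI[of _ A],
          rule exI[of _ "1\<^sub>m n"])
        (use True Suc.prems in \<open>auto simp: unitary_mat_one block_diag_empty diagonal_mat_def\<close>)
  next
    case False
    have "n \<noteq> 0"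
    proof
      assume "n = 0"
      hence "std_mat A = 0\<^sub>m (Suc m) n" using Suc.prems by (auto intro!: eq_matI)
      thus False using False by simp
    qed
    then obtain p where n: "n = Suc p" by (cases n) auto
    obtain u v s where u: "u \<in> carrier_mat (Suc m) 1" "adj u * u = 1\<^sub>m 1"
      and v: "v \<in> carrier_mat n 1" "adj v * v = 1\<^sub>m 1"
      and s: "positive_appreciable s" "A * v = s \<cdot>\<^sub>m u" "adj A * u = s \<cdot>\<^sub>m v"
      using appreciable_singular_pair[OF Suc.prems False] by blast
    obtain U0 where U0: "unitary_mat (Suc m) U0" "U0 * unit_col (Suc m) 0 = u"
      using dual_unitary_completion[OF u] by blast
    obtain V0 where V0: "unitary_mat (Suc p) V0" "V0 * unit_col (Suc p) 0 = v"
      using dual_unitary_completion[OF v] n by blast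
    from unitary_unit_col_deflation[OF Suc.prems[unfolded n] U0 V0 s(2,3)]
    obtain B where B: "B \<in> carrier_mat m p" and A: "A = U0 * block_diag (mat 1 1 (\<lambda>_. s)) B * adj V0" by blast
    from Suc.IH[OF B] obtain r U S R V where r: "r \<le> m" "r \<le> p"
      and U: "unitary_mat m U" and V: "unitary_mat p V"
      and S: "S \<in> carrier_mat r r" "diagonal_mat S" "\<forall>i<r. positive_appreciable (S $$ (i, i))"
      and R: "R \<in> carrier_mat (m - r) (p - r)" "std_mat R = 0\<^sub>m (m - r) (p - r)"
      and BR: "B = U * block_diag S R * adj V" by blast
    note uu = unitary_matD[OF U0(1)] unitary_matD[OF U]
    note vv = unitary_matD[OF V0(1)] unitary_matD[OF V]
    let ?c = "mat 1 1 (\<lambda>_. s)"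
    have "A = (U0 * block_diag (1\<^sub>m 1) U) * block_diag (block_diag ?c S) R * adj (V0 * block_diag (1\<^sub>m 1) V)"
      using block_diag_deflate[OF A[unfolded BR]] uu vv r S R by (simp add: block_diag_assoc)
    moreover have "unitary_mat (Suc m) (U0 * block_diag (1\<^sub>m 1) U)"
      using unitary_mat_mult[OF U0(1)] unitary_block_diag[OF unitary_mat_one[of 1] U] by simp
    moreover have "unitary_mat n (V0 * block_diag (1\<^sub>m 1) V)"
      using unitary_mat_mult[OF V0(1)] unitary_block_diag[OF unitary_mat_one[of 1] V] by (simp add: n)
    moreover have "block_diag ?c S \<in> carrier_mat (Suc r) (Suc r)" using S by auto
    moreover have "diagonal_mat (block_diag ?c S)"
      by (rule block_diag_diagonal[of _ _ 1]) (use S in \<open>auto simp: diagonal_mat_def\<close>)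
    moreover have "\<forall>i<Suc r. positive_appreciable (block_diag ?c S $$ (i, i))"
      using S s(1) by (auto simp: block_diag_def)
    ultimately show ?thesis using r R n
      by (intro exI[of _ "Suc r"] exI[of _ "U0 * block_diag (1\<^sub>m 1) U"] exI[of _ "block_diag ?c S"]
          exI[of _ R] exI[of _ "V0 * block_diag (1\<^sub>m 1) V"]) simp
  qed
qed

lemma std_mat_block_diag: "std_mat (block_diag A B) = block_diag (std_mat A) (std_mat B)"
  by (rule eq_matI) (auto simp: block_diag_def)

text \<open>Discarding the infinitesimal part keeps a matrix unitary. Such factors suffice to
  diagonalize a block that is a multiple of eps.\<close>

lemma unitary_lift:
  assumes "unitary_mat n U"
  shows "unitary_mat n (dual_mat (std_mat U) (0\<^sub>m n n))"
proof -
  note u = unitary_matD[OF assms]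
  have s: "adj (std_mat U) * std_mat U = 1\<^sub>m n" "std_mat U * adj (std_mat U) = 1\<^sub>m n"
    using arg_cong[OF u(3), of std_mat] arg_cong[OF u(4), of std_mat] u(1,2) by (simp_all add: std_mat_mult)
  have z: "0\<^sub>m n n * M = 0\<^sub>m n n" "M * 0\<^sub>m n n = 0\<^sub>m n n" if "dim_row M = n" "dim_col M = n" for M :: "complex mat"
    using that by (auto intro!: left_mult_zero_mat right_mult_zero_mat)
  show ?thesis
    unfolding unitary_mat_def
    by (intro conjI dual_mat_eqI carrier_matI) (simp_all add: std_mat_mult inf_mat_mult u s z)
qed

lemma is_dc_svd_iff:
  assumes "A \<in> carrier_mat m n" "S1 \<in> carrier_mat r r" "S2 \<in> carrier_mat (m - r) (n - r)"
  shows "is_dc_svd A r U S1 S2 V \<longleftrightarrow> r \<le> m \<and> r \<le> n \<and> unitary_mat m U \<and> unitary_mat n V \<and>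
    diagonal_mat S1 \<and> (\<forall>i<r. positive_appreciable (S1 $$ (i, i))) \<and> diagonal_mat S2 \<and>
    (\<forall>i<min (m - r) (n - r). positive_infinitesimal (S2 $$ (i, i)) \<or> S2 $$ (i, i) = 0) \<and>
    A = U * block_diag S1 S2 * adj V"
proof -
  have "dim_row A = m" "dim_col A = n" "dim_row S1 = r" "dim_col S1 = r"
    "dim_row S2 = m - r" "dim_col S2 = n - r"
    using assms by auto
  thus ?thesis using assms
    by (simp add: is_dc_svd_def Let_def unitary_dc_eq ctranspose_eq_adj block_diag_def)
qed

lemma dual_svd_exists:
  assumes A: "A \<in> carrier_mat m n"
  shows "\<exists>r U S1 S2 V. is_dc_svd A r U S1 S2 V"
proof -
  from appreciable_svd[OF A] obtain r U S R V where r: "r \<le> m" "r \<le> n"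
    and U: "unitary_mat m U" and V: "unitary_mat n V"
    and S: "S \<in> carrier_mat r r" "diagonal_mat S" "\<forall>i<r. positive_appreciable (S $$ (i, i))"
    and R: "R \<in> carrier_mat (m - r) (n - r)" "std_mat R = 0\<^sub>m (m - r) (n - r)"
    and AR: "A = U * block_diag S R * adj V" by blast
  define p where "p = m - r"
  define q where "q = n - r"
  have dR: "dim_row R = p" "dim_col R = q" using R by (auto simp: p_def q_def)
  \<comment> \<open>The standard part of this decomposition of $N + 0\epsilon$, where $R = N\epsilon$, is an SVD of $N$.\<close>
  have "dual_mat (inf_mat R) (0\<^sub>m p q) \<in> carrier_mat p q" using dR by auto
  from appreciable_svd[OF this] obtain k X T Q Y where k: "k \<le> p" "k \<le> q"
    and X: "unitary_mat p X" and Y: "unitary_mat q Y"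
    and T: "T \<in> carrier_mat k k" "diagonal_mat T" "\<forall>i<k. positive_appreciable (T $$ (i, i))"
    and Q: "Q \<in> carrier_mat (p - k) (q - k)" "std_mat Q = 0\<^sub>m (p - k) (q - k)"
    and NQ: "dual_mat (inf_mat R) (0\<^sub>m p q) = X * block_diag T Q * adj Y" by blast
  note x = unitary_matD[OF X] and y = unitary_matD[OF Y]
  have dQ: "dim_row Q = p - k" "dim_col Q = q - k" "dim_row T = k" "dim_col T = k" using Q T by auto
  \<comment> \<open>\<open>Q\<close> has zero standard part, so its block becomes zero here.\<close>
  define N where "N = block_diag (std_mat T) (0\<^sub>m (p - k) (q - k))"
  have dN: "dim_row N = p" "dim_col N = q" using k dQ by (simp_all add: N_def)
  have RN: "inf_mat R = std_mat X * N * adj (std_mat Y)"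
    using arg_cong[OF NQ, of std_mat] x y k dQ
    by (simp add: std_mat_mult std_mat_block_diag Q(2) N_def)
  define S2 where "S2 = dual_mat (0\<^sub>m p q) N"
  define X0 where "X0 = dual_mat (std_mat X) (0\<^sub>m p p)"
  define Y0 where "Y0 = dual_mat (std_mat Y) (0\<^sub>m q q)"
  have X0: "unitary_mat p X0" and Y0: "unitary_mat q Y0"
    unfolding X0_def Y0_def by (intro unitary_lift X Y)+
  \<comment> \<open>Multiplying \<open>inf_mat R = std_mat X * N * adj (std_mat Y)\<close> by eps:
    the diagonal of \<open>S2 = N eps\<close> then consists of positive infinitesimals and
    zeros.\<close>
  have R0: "R = X0 * S2 * adj Y0"
  proof (rule dual_mat_eqI)
    have c: "std_mat X \<in> carrier_mat p p" "adj (std_mat Y) \<in> carrier_mat q q" "N \<in> carrier_mat p q"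
      using x y dN by auto
    show "std_mat R = std_mat (X0 * S2 * adj Y0)"
      using c x y R(2) by (simp add: std_mat_mult X0_def Y0_def S2_def p_def q_def)
    show "inf_mat R = inf_mat (X0 * S2 * adj Y0)"
      using c x y dN by (simp add: std_mat_mult inf_mat_mult X0_def Y0_def S2_def RN)
  qed
  note xx = unitary_matD[OF X0] and yy = unitary_matD[OF Y0]
  note u = unitary_matD[OF U] and v = unitary_matD[OF V]
  have "A = (U * block_diag (1\<^sub>m r) X0) * block_diag S S2 * adj (V * block_diag (1\<^sub>m r) Y0)"
    using block_diag_deflate[OF AR[unfolded R0]] xx yy u v S r by (simp add: S2_def p_def q_def)
  moreover have "unitary_mat m (U * block_diag (1\<^sub>m r) X0)" "unitary_mat n (V * block_diag (1\<^sub>m r) Y0)"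
    using unitary_mat_mult[OF U] unitary_block_diag[OF unitary_mat_one[of r] X0]
      unitary_mat_mult[OF V] unitary_block_diag[OF unitary_mat_one[of r] Y0] r
    by (simp_all add: p_def q_def)
  moreover have dS2: "S2 \<in> carrier_mat (m - r) (n - r)" by (auto simp: S2_def p_def q_def)
  moreover have "diagonal_mat S2"
    using T k dQ by (auto simp: diagonal_mat_def S2_def N_def block_diag_def zero_dual_complex_def)
  moreover have "\<forall>i<min (m - r) (n - r). positive_infinitesimal (S2 $$ (i, i)) \<or> S2 $$ (i, i) = 0"
    using T k dQ
    by (auto simp: S2_def N_def block_diag_def zero_dual_complex_def positive_infinitesimal_def
        positive_appreciable_def is_dual_number_def p_def[symmetric] q_def[symmetric])
  ultimately have "is_dc_svd A r (U * block_diag (1\<^sub>m r) X0) S S2 (V * block_diag (1\<^sub>m r) Y0)"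
    unfolding is_dc_svd_iff[OF A S(1) dS2] using r S by blast
  thus ?thesis by blast
qed

section \<open>From decompositions to the essential part\<close>

lemma appreciable_inverse:
  assumes "positive_appreciable x"
  shows "x * DC (1 / std_part x) (- inf_part x / (std_part x)\<^sup>2) = 1"
  using assms
  by (auto simp: positive_appreciable_def dual_complex_eq_iff field_simps power2_eq_square)

lemma appreciable_diagonal_inverse:
  assumes S: "S \<in> carrier_mat r r" "diagonal_mat S" "\<forall>i<r. positive_appreciable (S $$ (i, i))"
  obtains T where "T \<in> carrier_mat r r" "S * T = 1\<^sub>m r" "T * S = 1\<^sub>m r"
proof -
  \<comment> \<open>The inverse of \<open>a + b eps\<close> is \<open>1/a - (b/a^2) eps\<close>, the
    geometric series cut off by \<open>eps^2 = 0\<close>.\<close>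
  define f where "f x = DC (1 / std_part x) (- inf_part x / (std_part x)\<^sup>2)" for x
  define T where "T = mat r r (\<lambda>(i, j). if i = j then f (S $$ (i, i)) else 0)"
  have T: "T \<in> carrier_mat r r" "diagonal_mat T" by (auto simp: T_def diagonal_mat_def)
  have f: "S $$ (i, i) * f (S $$ (i, i)) = 1" "f (S $$ (i, i)) * S $$ (i, i) = 1" if "i < r" for i
    using appreciable_inverse[of "S $$ (i, i)"] S(3) that by (simp_all add: f_def mult.commute)
  have "S * T = 1\<^sub>m r"
  proof (rule eq_matI)
    fix i j assume "i < dim_row (1\<^sub>m r :: dual_complex mat)" "j < dim_col (1\<^sub>m r :: dual_complex mat)"
    thus "(S * T) $$ (i, j) = 1\<^sub>m r $$ (i, j)"
      using diagonal_mult_index[OF S(2,1), of T i j] f by (simp add: T_def)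
  qed (use S T in auto)
  moreover have "T * S = 1\<^sub>m r"
  proof (rule eq_matI)
    fix i j assume "i < dim_row (1\<^sub>m r :: dual_complex mat)" "j < dim_col (1\<^sub>m r :: dual_complex mat)"
    thus "(T * S) $$ (i, j) = 1\<^sub>m r $$ (i, j)"
      using diagonal_mult_index[OF T(2,1), of S i j] f S by (auto simp: T_def diagonal_mat_def)
  qed (use S T in auto)
  ultimately show ?thesis using that T by blast
qed

lemma unitary_sandwich_mult:
  assumes "unitary_mat n V" "dim_col P = n" "dim_row Q = n" "dim_col U = dim_row P" "dim_col W = dim_col Q"
  shows "(U * P * adj V) * (V * Q * adj W) = U * (P * Q) * adj W"
  using assms(2-) unitary_matD[OF assms(1)] by (simp add: mult_assoc_dim)

lemma essential_part_pair:
  assumes "is_essential_part A E"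
  shows "\<exists>X. essential_pair A E X"
proof -
  define m where "m = dim_row A"
  define n where "n = dim_col A"
  from assms obtain r U S1 S2 V where r: "r \<le> m" "r \<le> n"
    and U: "unitary_mat m U" and V: "unitary_mat n V"
    and S: "S1 \<in> carrier_mat r r" "diagonal_mat S1" "\<forall>i<r. positive_appreciable (S1 $$ (i, i))"
    and S2: "S2 \<in> carrier_mat (m - r) (n - r)" "diagonal_mat S2"
      "\<forall>i<min (m - r) (n - r). positive_infinitesimal (S2 $$ (i, i)) \<or> S2 $$ (i, i) = 0"
    and A4: "A = U * four_block_mat S1 (0\<^sub>m r (n - r)) (0\<^sub>m (m - r) r) S2 * adj V"
    and E4: "E = U * four_block_mat S1 (0\<^sub>m r (n - r)) (0\<^sub>m (m - r) r) (0\<^sub>m (m - r) (n - r)) * adj V"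
    unfolding is_essential_part_def is_dc_svd_def Let_def m_def[symmetric] n_def[symmetric]
      ctranspose_eq_adj unitary_dc_eq by blast
  define p where "p = m - r"
  define q where "q = n - r"
  have m: "m = r + p" and n: "n = r + q" using r by (auto simp: p_def q_def)
  note S2 = S2[folded p_def q_def]
  have d: "dim_row S1 = r" "dim_col S1 = r" "dim_row S2 = p" "dim_col S2 = q" using S S2 by auto
  have A: "A = U * block_diag S1 S2 * adj V" and E: "E = U * block_diag S1 (0\<^sub>m p q) * adj V"
    using A4 E4 by (simp_all add: block_diag_def d p_def q_def)
  obtain T where T: "T \<in> carrier_mat r r" "S1 * T = 1\<^sub>m r" "T * S1 = 1\<^sub>m r"
    using appreciable_diagonal_inverse[OF S] by blast
  have dT: "dim_row T = r" "dim_col T = r" using T by auto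
  note u = unitary_matD[OF U] and v = unitary_matD[OF V]
  \<comment> \<open>The SVD formula for the NDMPI. Its zero block annihilates \<open>S2\<close>, so
    \<open>A\<close> and \<open>E\<close> have the same products with \<open>X\<close>.\<close>
  define X where "X = V * block_diag T (0\<^sub>m q p) * adj U"
  have z: "S2 * 0\<^sub>m q p = 0\<^sub>m p p" "0\<^sub>m q p * S2 = 0\<^sub>m q q" using S2 by auto
  have one: "1\<^sub>m r * S1 = S1" "1\<^sub>m r * T = T" using S(1) T(1) by auto
  have dims: "dim_row (block_diag S1 M) = r + dim_row M" "dim_col (block_diag S1 M) = r + dim_col M"
    "dim_row (block_diag T M) = r + dim_row M" "dim_col (block_diag T M) = r + dim_col M"
    "dim_row (block_diag (1\<^sub>m r) M) = r + dim_row M" "dim_col (block_diag (1\<^sub>m r) M) = r + dim_col M"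
    for M :: "dual_complex mat" by (simp_all add: d dT)
  have EX: "E * X = U * block_diag (1\<^sub>m r) (0\<^sub>m p p) * adj U"
    unfolding E X_def
    by (subst unitary_sandwich_mult[OF V]) (simp_all add: dims u v m n block_diag_mult d dT T)
  have XE: "X * E = V * block_diag (1\<^sub>m r) (0\<^sub>m q q) * adj V"
    unfolding E X_def
    by (subst unitary_sandwich_mult[OF U]) (simp_all add: dims u v m n block_diag_mult d dT T)
  have AX: "A * X = E * X"
    unfolding EX unfolding A X_def
    by (subst unitary_sandwich_mult[OF V]) (simp_all add: dims u v m n block_diag_mult d dT T z)
  have XA: "X * A = X * E"
    unfolding XE unfolding A X_def
    by (subst unitary_sandwich_mult[OF U]) (simp_all add: dims u v m n block_diag_mult d dT T z)
  have "E * X * E = E"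
    unfolding EX unfolding E
    by (subst unitary_sandwich_mult[OF U]) (simp_all add: dims u v m n block_diag_mult d dT one)
  moreover have "X * E * X = X"
    unfolding XE unfolding X_def
    by (subst unitary_sandwich_mult[OF V]) (simp_all add: dims u v m n block_diag_mult d dT one)
  moreover have "adj (E * X) = E * X" "adj (X * E) = X * E"
    unfolding EX XE using u v
    by (simp_all add: adj_mult adj_block_diag mult_assoc_dim m n)
  moreover have "dim_row X = dim_col E" "dim_col X = dim_row E" by (simp_all add: X_def E u v)
  ultimately have "penrose E X" by (simp add: penrose_def)
  moreover have "std_mat A = std_mat E"
  proof -
    have "std_mat S2 = 0\<^sub>m p q"
    proof (rule eq_matI)
      fix i j assume "i < dim_row (0\<^sub>m p q :: complex mat)" "j < dim_col (0\<^sub>m p q :: complex mat)"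
      thus "std_mat S2 $$ (i, j) = 0\<^sub>m p q $$ (i, j)"
        using S2(2,3) d by (cases "i = j") (auto simp: diagonal_mat_def positive_infinitesimal_def)
    qed (simp_all add: d)
    thus ?thesis
      by (simp add: A E std_mat_mult u v d m n std_mat_block_diag)
  qed
  ultimately show ?thesis using AX XA by (auto simp: essential_pair_def)
qed

text \<open>Every candidate belongs to an \<open>essential_pair\<close> and is thereby unique, so
  the definite description denotes.\<close>

lemma essential_part_exists:
  obtains X where "essential_pair A (essential_part A) X"
proof -
  obtain E where E: "is_essential_part A E"
    using dual_svd_exists[OF carrier_mat_triv[of A]] unfolding is_essential_part_def by blast
  have "\<exists>!E. is_essential_part A E"
    using E essential_part_pair essential_pair_unique by blast
  hence "is_essential_part A (essential_part A)" unfolding essential_part_def by (rule theI')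
  thus ?thesis using essential_part_pair that by blast
qed

section \<open>Reverse order law\<close>

lemma is_ndmpi_ndmpi: "is_ndmpi A (ndmpi A)"
proof -
  obtain X where "essential_pair A (essential_part A) X" by (rule essential_part_exists)
  hence char: "is_ndmpi A Z \<longleftrightarrow> Z = X" for Z by (rule ndmpi_characterization[OF refl])
  show ?thesis unfolding ndmpi_def by (rule theI[of "is_ndmpi A" X]) (simp_all add: char)
qed

text \<open>Essential parts enter only as \<open>A * a * A\<close> and \<open>B * b * B\<close>,
  which turns the claim into pure algebra over a commutative ring with conjugation.\<close>

lemma reverse_order_law:
  fixes A B a b Y :: "'a :: {comm_ring_1, conjugatable_ring} mat"
  assumes dims: "A \<in> carrier_mat m q" "B \<in> carrier_mat q n" "a \<in> carrier_mat q m"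
      "b \<in> carrier_mat n q"
    and a: "a * A * a = a" "adj (A * a) = A * a" "adj (a * A) = a * A"
    and b: "b * B * b = b" "adj (B * b) = B * b" "adj (b * B) = b * B"
    and Y: "penrose (A * B) Y"
    and h1: "a * A * (B * b * B) = B * Y * A * B"
    and h2: "B * b * adj (A * a * A) = adj A * A * B * Y"
  shows "Y = b * a"
proof -
  have y: "A * B * Y * (A * B) = A * B" "Y * (A * B) * Y = Y" "adj (A * B * Y) = A * B * Y"
      "adj (Y * (A * B)) = Y * (A * B)" and dY: "dim_row Y = dim_col B" "dim_col Y = dim_row A"
    using Y unfolding penrose_def index_mult_mat by blast+
  from dims dY have d [simp]: "dim_row A = m" "dim_col A = q" "dim_row B = q" "dim_col B = n"
      "dim_row a = q" "dim_col a = m" "dim_row b = n" "dim_col b = q" "dim_row Y = n" "dim_col Y = m"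
    by auto
  define p where "p = a * A"
  define s where "s = B * b"
  define t where "t = A * a"
  define w where "w = b * B"
  define C where "C = A * B"
  have dd [simp]: "dim_row p = q" "dim_col p = q" "dim_row s = q" "dim_col s = q"
    "dim_row t = m" "dim_col t = m" "dim_row w = n" "dim_col w = n" "dim_row C = m" "dim_col C = n"
    by (simp_all add: p_def s_def t_def w_def C_def)
  note asc = mult_assoc_dim
  have aAa: "a * (A * a) = a" and bBb: "b * (B * b) = b"
    using a(1) b(1) by (simp_all add: asc)
  have pp: "p * p = p" unfolding p_def using a(1) by (simp add: asc[symmetric])
  have ss: "s * s = s" unfolding s_def using b(1) by (simp add: asc bBb)
  have h1': "p * (s * B) = B * (Y * C)"
    using h1 by (simp add: p_def s_def C_def asc)
  have YCY: "Y * (C * Y) = Y" and CYC: "C * (Y * C) = C" using y by (simp_all add: C_def asc)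
  have pBY: "p * (B * Y) = B * Y"
  proof -
    have "B * Y = B * (Y * C) * Y" by (simp add: asc YCY)
    also have "\<dots> = p * (s * B) * Y" by (simp add: h1')
    finally have 1: "B * Y = p * (s * B) * Y" .
    have "p * (B * Y) = (p * p) * (s * B) * Y" unfolding 1 by (simp add: asc)
    thus ?thesis using 1 by (simp add: pp)
  qed
  have CEF: "A * (p * (s * B)) = C"
    using h1' CYC by (simp add: C_def asc)
  have Es: "A * (p * s) = C * (Y * A)"
  proof -
    have "A * (p * s) = adj (s * adj (A * p))" 
      using b(2) by (simp add: adj_mult s_def asc)
    also have "s * adj (A * p) = adj A * (A * B * Y)"
      using h2 by (simp add: s_def p_def asc)
    also have "adj \<dots> = adj (A * B * Y) * A" by (simp add: adj_mult)
    finally show ?thesis unfolding y(3) by (simp add: C_def asc)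
  qed
  have ps: "p * s = B * (Y * A)"
  proof -
    have "p * s = (p * p) * s" by (simp add: pp)
    also have "\<dots> = a * (A * (p * s))" by (simp add: p_def asc)
    also have "\<dots> = p * (B * Y) * A" unfolding Es by (simp add: p_def C_def asc)
    finally show ?thesis unfolding pBY by (simp add: asc)
  qed
  have "C * w = A * (p * (s * B)) * w" by (simp only: CEF)
  also have "\<dots> = A * (p * ((s * s) * B))" by (simp add: w_def s_def asc)
  finally have "C * w = A * (p * ((s * s) * B))" .
  hence "C * w = C" by (simp add: ss CEF)
  hence "adj (w * (Y * C)) = adj (Y * C)"
    using y(4) b(3) by (simp add: adj_mult[of w] C_def[symmetric] w_def[symmetric] asc)
  hence wYC: "w * (Y * C) = Y * C" by (metis adj_adj)
  have "w * Y = w * (Y * C) * Y" by (simp add: asc YCY)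
  hence wY: "w * Y = Y" by (simp add: wYC asc YCY)
  have "s * (B * Y) = B * (w * Y)" by (simp add: s_def w_def asc)
  hence sBY: "s * (B * Y) = B * Y" by (simp add: wY)
  have sps: "s * (p * s) = p * s"
    using arg_cong[OF sBY, of "\<lambda>M. M * A"] by (simp add: ps asc)
  have comm: "s * p = p * s"
  proof -
    have sa: "adj s = s" and pa: "adj p = p" using a(3) b(2) by (simp_all add: s_def p_def)
    have "s * p = adj (s * (p * s))" by (simp add: sps adj_mult sa pa)
    also have "\<dots> = s * (p * s)" by (simp add: adj_mult sa pa asc)
    finally show ?thesis by (simp add: sps)
  qed
  have "t * C = t * (A * (p * (s * B)))" by (simp only: CEF)
  also have "\<dots> = A * ((p * p) * (s * B))" by (simp add: t_def p_def asc)
  finally have "t * C = A * ((p * p) * (s * B))" .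
  hence "t * C = C" by (simp add: pp CEF)
  hence "t * (C * Y) = C * Y" using asc[of t C Y] by simp
  hence "adj (t * (C * Y)) = C * Y" using y(3) by (simp add: C_def)
  hence CYt: "C * (Y * t) = C * Y"
    using y(3) a(2) by (simp add: adj_mult[of t] C_def[symmetric] t_def[symmetric] asc)
  have apa: "a = p * a" using aAa by (simp add: p_def asc)
  have bs: "b = b * s" using bBb by (simp add: s_def)
  have CZ: "C * (b * a) = C * Y"
  proof -
    have "C * (b * a) = A * (s * (p * a))" unfolding apa[symmetric] by (simp add: C_def s_def asc)
    also have "\<dots> = A * ((s * p) * a)" by (simp add: asc)
    also have "\<dots> = (A * (p * s)) * a" by (simp add: comm asc)
    also have "\<dots> = C * (Y * t)" by (simp add: Es t_def asc)
    finally show ?thesis by (simp add: CYt)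
  qed
  have ZC: "b * a * C = Y * C"
  proof -
    have "b * a * C = b * a * (A * (p * (s * B)))" by (simp only: CEF)
    also have "\<dots> = b * ((p * p) * (s * B))" by (simp add: p_def asc)
    also have "\<dots> = w * (Y * C)" by (simp add: pp h1' w_def asc)
    finally show ?thesis by (simp add: wYC)
  qed
  have "b * a = (b * s) * (p * a)" by (simp only: bs[symmetric] apa[symmetric])
  also have "\<dots> = b * ((s * p) * a)" by (simp add: asc)
  also have "\<dots> = (b * a * C) * (b * a)" unfolding comm by (simp add: p_def s_def C_def asc)
  also have "\<dots> = Y * (C * (b * a))" by (simp add: ZC asc)
  finally show ?thesis by (simp add: CZ YCY)
qed

lemma is_dmpgi_iff_penrose: "is_dmpgi A X \<longleftrightarrow> penrose A X"
  by (auto simp: is_dmpgi_def penrose_def ctranspose_eq_adj)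

theorem theorem3p6:
  fixes A B :: "dual_complex mat" and m q n :: nat
  assumes "A \<in> carrier_mat m q" and "B \<in> carrier_mat q n"
    and "essential_part (A * B) = A * B"
    and "ndmpi A * A * essential_part B = B * ndmpi (A * B) * A * B"
    and "B * ndmpi B * ctranspose (essential_part A)
           = ctranspose A * A * B * ndmpi (A * B)"
  shows "(\<exists>!X. is_dmpgi (A * B) X) \<and>
         dmpgi (A * B) = ndmpi (A * B) \<and>
         ndmpi (A * B) = ndmpi B * ndmpi A"
proof -
  define Y where "Y = ndmpi (A * B)"
  have Y: "penrose (A * B) Y"
    using is_ndmpi_ndmpi[of "A * B"] unfolding Y_def[symmetric] is_ndmpi_def assms(3)
    by (auto simp: penrose_def ctranspose_eq_adj)
  have a: "ndmpi A \<in> carrier_mat q m" "ndmpi A * A * ndmpi A = ndmpi A"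
    "adj (A * ndmpi A) = A * ndmpi A" "adj (ndmpi A * A) = ndmpi A * A" "A * ndmpi A * A = essential_part A"
    using is_ndmpi_ndmpi[of A] assms(1) by (auto simp: is_ndmpi_def ctranspose_eq_adj)
  have b: "ndmpi B \<in> carrier_mat n q" "ndmpi B * B * ndmpi B = ndmpi B"
    "adj (B * ndmpi B) = B * ndmpi B" "adj (ndmpi B * B) = ndmpi B * B" "B * ndmpi B * B = essential_part B"
    using is_ndmpi_ndmpi[of B] assms(2) by (auto simp: is_ndmpi_def ctranspose_eq_adj)
  have "Y = ndmpi B * ndmpi A"
    by (rule reverse_order_law[OF assms(1,2) a(1) b(1) a(2-4) b(2-4) Y])
      (use assms(4,5) in \<open>simp_all add: a(5) b(5) Y_def ctranspose_eq_adj\<close>)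
  moreover have "is_dmpgi (A * B) X \<longleftrightarrow> X = Y" for X
    using Y penrose_unique by (auto simp: is_dmpgi_iff_penrose)
  ultimately show ?thesis unfolding dmpgi_def Y_def by auto
qed

end
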